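(* Let $X$ be in Class 1 or Class 2, let $\alpha>0$, $x\in I$, $y>0$ and $\eta>x\vee(y+l)$. Then $$\mathbf E_x\left(e^{-\alpha H_\eta};\,D^-_{H_\eta}<y\right)=\frac{\psi_\alpha(x)}{\psi_\alpha(x\vee(y+l))}\exp\left(-\int_{x\vee(y+l)}^{\eta}b_\alpha(z;y)\,S(dz)\right),$$ where $$b_\alpha(z;y):=\frac{\varphi_\alpha(z-y)\psi_\alpha^-(z)-\varphi_\alpha^-(z)\psi_\alpha(z-y)}{\varphi_\alpha(z-y)\psi_\alpha(z)-\varphi_\alpha(z)\psi_\alpha(z-y)}.$$
   Context: $X=(X_t)_{t\ge 0}$ is a regular one-dimensional diffusion in the sense of Itô and McKean (strong Markov, continuous paths) on an interval $I\subseteq\mathbb R$ with left endpoint $l\ge-\infty$ and right endpoint $r=+\infty$, not killed inside $I$. $\mathbf P_x,\mathbf E_x$ denote probability and expectation when $X_0=x$; $\mathbf E_x(Y;A)=\mathbf E_x(Y\mathbf 1_A)$. $S$ is the scale function, assumed continuously differentiable, and $m$ is the speed measure, assumed to have a continuous density with respect to Lebesgue measure; the generator is $\frac{d}{dm}\frac{d}{dS}$. Class 1: $X$ is recurrent with either (a) $S(+\infty)=+\infty$, $S(l)=-\infty$, or (b) $S(+\infty)=+\infty$, $S(l)>-\infty$, $l>-\infty$ and $l$ reflecting. Class 2: $X$ is transient with either (a) $S(+\infty)<\infty$, $S(l)=-\infty$, or (b) $S(+\infty)<\infty$, $S(l)>-\infty$, $l>-\infty$ and $l$ reflecting. For $\alpha>0$,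 $\psi_\alpha$ (increasing) and $\varphi_\alpha$ (decreasing) are the positive solutions of $\frac{d}{dm}\frac{d}{dS}u=\alpha u$, unique up to multiplicative constants under the appropriate boundary conditions, such that, with $H_y:=\inf\{t\ge0: X_t=y\}$, $\mathbf E_x(e^{-\alpha H_y})=\psi_\alpha(x)/\psi_\alpha(y)$ for $x\le y$ and $\mathbf E_x(e^{-\alpha H_y})=\varphi_\alpha(x)/\varphi_\alpha(y)$ for $x\ge y$. The superscript $^-$ denotes the left derivative with respect to $S$. $M_t:=\max_{0\le s\le t}X_s$ and $D^-_t:=\max_{0\le s\le t}(M_s-X_s)$. $S(dz)=dS(z)$, $a\vee b=\max(a,b)$; if $l=-\infty$ then $x\vee(y+l)=x$. *)

theory Defs
  imports "HOL-Probability.Probability"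
begin

section \<open>Path functionals\<close>

text \<open>
  A process is a family \<open>X t\<close>, \<open>t \<ge> 0\<close>, of extended-real-valued random variables on a measurable
  space \<open>M\<close> (only its sample space and sigma-algebra matter), and \<open>P x\<close> is the law under which \<open>X\<close>
  starts at \<open>x\<close>. The value \<open>\<infinity>\<close> is the right endpoint of the state space adjoined as an absorbing
  point. A transient diffusion may reach it in finite time, so explosion is allowed, but is not
  required to happen.
\<close>

definition hit :: "(real \<Rightarrow> 'w \<Rightarrow> ereal) \<Rightarrow> real \<Rightarrow> 'w \<Rightarrow> ennreal" where
  "hit X y \<omega> = (INF t\<in>{t. 0 \<le> t \<and> X t \<omega> = ereal y}. ennreal t)"

definition running_max :: "(real \<Rightarrow> 'w \<Rightarrow> ereal) \<Rightarrow> real \<Rightarrow> 'w \<Rightarrow> ereal" where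
  "running_max X t \<omega> = (SUP s\<in>{0..t}. X s \<omega>)"

text \<open>
  The maximum decrease \<open>D\<^sup>-\<close>. Before explosion all quantities are finite and, by continuity of the
  paths, both suprema are maxima.
\<close>

definition max_decrease :: "(real \<Rightarrow> 'w \<Rightarrow> ereal) \<Rightarrow> real \<Rightarrow> 'w \<Rightarrow> ereal" where
  "max_decrease X t \<omega> = (SUP s\<in>{0..t}. running_max X s \<omega> - X s \<omega>)"

text \<open>\<open>exp (- \<alpha> T)\<close>, with value \<open>0\<close> where \<open>T = \<infinity>\<close>.\<close>

definition discount :: "real \<Rightarrow> ennreal \<Rightarrow> real" where
  "discount \<alpha> T = (if T = \<infinity> then 0 else exp (- \<alpha> * enn2real T))"


section \<open>Regular diffusions\<close>

definition past :: "'w measure \<Rightarrow> (real \<Rightarrow> 'w \<Rightarrow> ereal) \<Rightarrow> real \<Rightarrow> 'w set set" where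
  "past M X t = sigma_sets (space M)
     {X s -` B \<inter> space M | s B. 0 \<le> s \<and> s \<le> t \<and> B \<in> sets borel}"

text \<open>
  Markov times \<open>T\<close> and the sigma-algebra of the past up to \<open>T+\<close>, in the sense of Ito and McKean;
  these are the stopping times of the right-continuous version of the natural filtration.
\<close>

definition markov_time :: "'w measure \<Rightarrow> (real \<Rightarrow> 'w \<Rightarrow> ereal) \<Rightarrow> ('w \<Rightarrow> ennreal) \<Rightarrow> bool" where
  "markov_time M X T \<longleftrightarrow> (\<forall>t>0. {\<omega>\<in>space M. T \<omega> < ennreal t} \<in> past M X t)"

definition markov_past :: "'w measure \<Rightarrow> (real \<Rightarrow> 'w \<Rightarrow> ereal) \<Rightarrow> ('w \<Rightarrow> ennreal) \<Rightarrow> 'w set set" where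
  "markov_past M X T =
     {A \<in> sets M. \<forall>t>0. A \<inter> {\<omega>\<in>space M. T \<omega> < ennreal t} \<in> past M X t}"

definition path_space :: "(real \<Rightarrow> ereal) measure" where
  "path_space = PiM {0..} (\<lambda>_. borel)"

definition path_from :: "(real \<Rightarrow> 'w \<Rightarrow> ereal) \<Rightarrow> real \<Rightarrow> 'w \<Rightarrow> real \<Rightarrow> ereal" where
  "path_from X s \<omega> = (\<lambda>t\<in>{0..}. X (s + t) \<omega>)"

definition path_law :: "(real \<Rightarrow> 'w measure) \<Rightarrow> (real \<Rightarrow> 'w \<Rightarrow> ereal) \<Rightarrow> real \<Rightarrow> (real \<Rightarrow> ereal) measure" where
  "path_law P X x = distr (P x) path_space (path_from X 0)"

text \<open>The event that \<open>T\<close> is finite and the process has not yet been absorbed at \<open>\<infinity>\<close> at time \<open>T\<close>.\<close>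

definition alive_at :: "(real \<Rightarrow> 'w \<Rightarrow> ereal) \<Rightarrow> ('w \<Rightarrow> ennreal) \<Rightarrow> 'w \<Rightarrow> bool" where
  "alive_at X T \<omega> \<longleftrightarrow> T \<omega> < \<infinity> \<and> X (enn2real (T \<omega>)) \<omega> < \<infinity>"

text \<open>
  The state space \<open>I\<close> is an interval with left endpoint \<open>l\<close>, which may or may not belong to \<open>I\<close>, and
  right endpoint \<open>\<infinity>\<close>; its interior is \<open>{z. l < ereal z}\<close>. Regularity asks that interior points be
  reached from everywhere in \<open>I\<close>, so an entrance boundary \<open>l\<close> may be counted as a starting point;
  accessibility of \<open>l\<close> is part of \<open>reflecting\<close> below. By \<open>state_values\<close> and \<open>continuous\<close> the process can only
  leave \<open>I\<close> by tending to \<open>\<infinity>\<close>: there is no killing inside \<open>I\<close>.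
\<close>

locale regular_diffusion =
  fixes M :: "'w measure"
    and P :: "real \<Rightarrow> 'w measure"
    and X :: "real \<Rightarrow> 'w \<Rightarrow> ereal"
    and l :: ereal
    and I :: "real set"
  assumes l_less_infty: "l < \<infinity>"
    and interior_subset: "{z. l < ereal z} \<subseteq> I"
    and subset_closure: "I \<subseteq> {z. l \<le> ereal z}"
    and prob_space_P: "\<And>x. x \<in> I \<Longrightarrow> prob_space (P x)"
    and sets_P: "\<And>x. x \<in> I \<Longrightarrow> sets (P x) = sets M"
    and measurable_X: "\<And>t. 0 \<le> t \<Longrightarrow> X t \<in> borel_measurable M"
    and state_values: "\<And>t \<omega>. 0 \<le> t \<Longrightarrow> \<omega> \<in> space M \<Longrightarrow> X t \<omega> \<in> ereal ` I \<union> {\<infinity>}"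
    and continuous: "\<And>\<omega>. \<omega> \<in> space M \<Longrightarrow> continuous_on {0..} (\<lambda>t. X t \<omega>)"
    and absorbed: "\<And>s t \<omega>. 0 \<le> s \<Longrightarrow> s \<le> t \<Longrightarrow> \<omega> \<in> space M \<Longrightarrow> X s \<omega> = \<infinity> \<Longrightarrow> X t \<omega> = \<infinity>"
    and start: "\<And>x. x \<in> I \<Longrightarrow> AE \<omega> in P x. X 0 \<omega> = ereal x"
    and kernel: "path_law P X \<in> restrict_space borel I \<rightarrow>\<^sub>M prob_algebra path_space"
    and strong_markov:
      "\<And>x T A B. x \<in> I \<Longrightarrow> markov_time M X T \<Longrightarrow> A \<in> markov_past M X T \<Longrightarrow> B \<in> sets path_space \<Longrightarrow>
         emeasure (P x) {\<omega>\<in>A. alive_at X T \<omega> \<and> path_from X (enn2real (T \<omega>)) \<omega> \<in> B} =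
         (\<integral>\<^sup>+ \<omega>\<in>{\<omega>\<in>A. alive_at X T \<omega>}.
            emeasure (path_law P X (real_of_ereal (X (enn2real (T \<omega>)) \<omega>))) B \<partial>P x)"
    and regular:
      "\<And>x y. x \<in> I \<Longrightarrow> l < ereal y \<Longrightarrow> 0 < measure (P x) {\<omega>\<in>space M. hit X y \<omega> < \<infinity>}"


section \<open>Scale function and speed measure\<close>

definition scale_function ::
  "'w measure \<Rightarrow> (real \<Rightarrow> 'w measure) \<Rightarrow> (real \<Rightarrow> 'w \<Rightarrow> ereal) \<Rightarrow> ereal \<Rightarrow> (real \<Rightarrow> real) \<Rightarrow> bool" where
  "scale_function M P X l S \<longleftrightarrow>
     continuous_on {z. l < ereal z} S \<and> strict_mono_on {z. l < ereal z} S \<and>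
     (\<forall>a x b. l < ereal a \<and> a < x \<and> x < b \<longrightarrow>
        measure (P x) {\<omega>\<in>space M. hit X a \<omega> < hit X b \<omega>} = (S b - S x) / (S b - S a))"

text \<open>
  The Green function of \<open>{a<..<b}\<close> without a factor \<open>2\<close>: \<open>u x = (\<integral>\<^sup>+ z. green S a b x z \<partial>m)\<close> solves
  \<open>d/dm d/dS u = - 1\<close> with \<open>u a = u b = 0\<close>. Requiring it to represent the mean exit times
  normalises \<open>m\<close> so that the generator is \<open>d/dm d/dS\<close>.
\<close>

definition green :: "(real \<Rightarrow> real) \<Rightarrow> real \<Rightarrow> real \<Rightarrow> real \<Rightarrow> real \<Rightarrow> real" where
  "green S a b x z = (S (min x z) - S a) * (S b - S (max x z)) / (S b - S a)"

definition speed_measure ::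
  "(real \<Rightarrow> 'w measure) \<Rightarrow> (real \<Rightarrow> 'w \<Rightarrow> ereal) \<Rightarrow> ereal \<Rightarrow> (real \<Rightarrow> real) \<Rightarrow> real measure \<Rightarrow> bool" where
  "speed_measure P X l S m \<longleftrightarrow> sets m = sets borel \<and>
     (\<forall>a x b. l < ereal a \<and> a < x \<and> x < b \<longrightarrow>
        (\<integral>\<^sup>+ \<omega>. min (hit X a \<omega>) (hit X b \<omega>) \<partial>P x) =
        (\<integral>\<^sup>+ z\<in>{a<..<b}. ennreal (green S a b x z) \<partial>m))"

definition continuously_differentiable :: "ereal \<Rightarrow> (real \<Rightarrow> real) \<Rightarrow> bool" where
  "continuously_differentiable l S \<longleftrightarrow>
     (\<exists>s. continuous_on {z. l < ereal z} s \<and>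
          (\<forall>z. l < ereal z \<longrightarrow> (S has_real_derivative s z) (at z)))"

text \<open>In particular \<open>m\<close> puts no mass on \<open>l\<close>, in agreement with \<open>reflecting\<close> below.\<close>

definition has_continuous_density :: "ereal \<Rightarrow> real measure \<Rightarrow> bool" where
  "has_continuous_density l m \<longleftrightarrow>
     (\<exists>d. continuous_on {z. l < ereal z} d \<and> (\<forall>z. l < ereal z \<longrightarrow> 0 \<le> d z) \<and>
          m = density lborel (\<lambda>z. ennreal (d z) * indicator {z. l < ereal z} z))"


section \<open>Boundary behaviour and classification\<close>

text \<open>As \<open>S\<close> is increasing, its limits at the endpoints are its infimum and supremum.\<close>

definition scale_left :: "ereal \<Rightarrow> (real \<Rightarrow> real) \<Rightarrow> ereal" where
  "scale_left l S = (INF z\<in>{z. l < ereal z}. ereal (S z))"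

definition scale_right :: "ereal \<Rightarrow> (real \<Rightarrow> real) \<Rightarrow> ereal" where
  "scale_right l S = (SUP z\<in>{z. l < ereal z}. ereal (S z))"

text \<open>
  (Instantaneous) reflection at \<open>l\<close>: \<open>l\<close> belongs to the state space, is reached from every point,
  and the time spent there has Lebesgue measure zero. That \<open>l\<close> is left again is part of regularity.
\<close>

definition reflecting ::
  "'w measure \<Rightarrow> (real \<Rightarrow> 'w measure) \<Rightarrow> (real \<Rightarrow> 'w \<Rightarrow> ereal) \<Rightarrow> ereal \<Rightarrow> real set \<Rightarrow> bool" where
  "reflecting M P X l I \<longleftrightarrow>
     l \<in> ereal ` I \<and>
     (\<forall>x\<in>I. 0 < measure (P x) {\<omega>\<in>space M. hit X (real_of_ereal l) \<omega> < \<infinity>}) \<and>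
     (\<forall>x\<in>I. AE \<omega> in P x. emeasure lborel {t. 0 \<le> t \<and> X t \<omega> = l} = 0)"

definition recurrent ::
  "'w measure \<Rightarrow> (real \<Rightarrow> 'w measure) \<Rightarrow> (real \<Rightarrow> 'w \<Rightarrow> ereal) \<Rightarrow> ereal \<Rightarrow> real set \<Rightarrow> bool" where
  "recurrent M P X l I \<longleftrightarrow>
     (\<forall>x\<in>I. \<forall>y. l < ereal y \<longrightarrow> measure (P x) {\<omega>\<in>space M. hit X y \<omega> < \<infinity>} = 1)"

abbreviation transient ::
  "'w measure \<Rightarrow> (real \<Rightarrow> 'w measure) \<Rightarrow> (real \<Rightarrow> 'w \<Rightarrow> ereal) \<Rightarrow> ereal \<Rightarrow> real set \<Rightarrow> bool" where
  "transient M P X l I \<equiv> \<not> recurrent M P X l I"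

definition class1 ::
  "'w measure \<Rightarrow> (real \<Rightarrow> 'w measure) \<Rightarrow> (real \<Rightarrow> 'w \<Rightarrow> ereal) \<Rightarrow> ereal \<Rightarrow> real set \<Rightarrow> (real \<Rightarrow> real) \<Rightarrow> bool" where
  "class1 M P X l I S \<longleftrightarrow> recurrent M P X l I \<and>
     (scale_right l S = \<infinity> \<and> scale_left l S = - \<infinity> \<or>
      scale_right l S = \<infinity> \<and> scale_left l S > - \<infinity> \<and> l > - \<infinity> \<and> reflecting M P X l I)"

definition class2 ::
  "'w measure \<Rightarrow> (real \<Rightarrow> 'w measure) \<Rightarrow> (real \<Rightarrow> 'w \<Rightarrow> ereal) \<Rightarrow> ereal \<Rightarrow> real set \<Rightarrow> (real \<Rightarrow> real) \<Rightarrow> bool" where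
  "class2 M P X l I S \<longleftrightarrow> transient M P X l I \<and>
     (scale_right l S < \<infinity> \<and> scale_left l S = - \<infinity> \<or>
      scale_right l S < \<infinity> \<and> scale_left l S > - \<infinity> \<and> l > - \<infinity> \<and> reflecting M P X l I)"


section \<open>The functions \<open>\<psi>\<close> and \<open>\<phi>\<close>\<close>

definition has_left_scale_deriv :: "(real \<Rightarrow> real) \<Rightarrow> (real \<Rightarrow> real) \<Rightarrow> real \<Rightarrow> real \<Rightarrow> bool" where
  "has_left_scale_deriv S u D z \<longleftrightarrow> ((\<lambda>t. (u t - u z) / (S t - S z)) \<longlongrightarrow> D) (at_left z)"

definition left_scale_deriv :: "(real \<Rightarrow> real) \<Rightarrow> (real \<Rightarrow> real) \<Rightarrow> real \<Rightarrow> real" where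
  "left_scale_deriv S u z = (THE D. has_left_scale_deriv S u D z)"

text \<open>Solutions of \<open>d/dm d/dS u = \<alpha> u\<close> on the interior of the state space, in integrated form.\<close>

definition generator_solution ::
  "ereal \<Rightarrow> (real \<Rightarrow> real) \<Rightarrow> real measure \<Rightarrow> real \<Rightarrow> (real \<Rightarrow> real) \<Rightarrow> bool" where
  "generator_solution l S m \<alpha> u \<longleftrightarrow>
     continuous_on {z. l < ereal z} u \<and>
     (\<forall>z. l < ereal z \<longrightarrow> (\<exists>D. has_left_scale_deriv S u D z)) \<and>
     (\<forall>a b. l < ereal a \<and> a < b \<longrightarrow>
        left_scale_deriv S u b - left_scale_deriv S u a = \<alpha> * (LINT z:{a..<b}|m. u z))"

text \<open>
  The hitting time identities single out the solutions satisfying the appropriate boundary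
  conditions and determine them up to a multiplicative constant. \<open>\<phi>\<close> is only considered on the
  interior, since it is infinite at an entrance boundary.
\<close>

definition increasing_solution ::
  "(real \<Rightarrow> 'w measure) \<Rightarrow> (real \<Rightarrow> 'w \<Rightarrow> ereal) \<Rightarrow> ereal \<Rightarrow> real set \<Rightarrow> (real \<Rightarrow> real) \<Rightarrow> real measure \<Rightarrow>
   real \<Rightarrow> (real \<Rightarrow> real) \<Rightarrow> bool" where
  "increasing_solution P X l I S m \<alpha> \<psi> \<longleftrightarrow>
     (\<forall>x\<in>I. 0 < \<psi> x) \<and> mono_on I \<psi> \<and> generator_solution l S m \<alpha> \<psi> \<and>
     (\<forall>x\<in>I. \<forall>y\<in>I. x \<le> y \<longrightarrow> (\<integral>\<omega>. discount \<alpha> (hit X y \<omega>) \<partial>P x) = \<psi> x / \<psi> y)"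

definition decreasing_solution ::
  "(real \<Rightarrow> 'w measure) \<Rightarrow> (real \<Rightarrow> 'w \<Rightarrow> ereal) \<Rightarrow> ereal \<Rightarrow> (real \<Rightarrow> real) \<Rightarrow> real measure \<Rightarrow>
   real \<Rightarrow> (real \<Rightarrow> real) \<Rightarrow> bool" where
  "decreasing_solution P X l S m \<alpha> \<phi> \<longleftrightarrow>
     (\<forall>x. l < ereal x \<longrightarrow> 0 < \<phi> x) \<and> antimono_on {z. l < ereal z} \<phi> \<and>
     generator_solution l S m \<alpha> \<phi> \<and>
     (\<forall>x y. l < ereal y \<and> y \<le> x \<longrightarrow> (\<integral>\<omega>. discount \<alpha> (hit X y \<omega>) \<partial>P x) = \<phi> x / \<phi> y)"


section \<open>Ingredients of the formula\<close>

definition b_rate ::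
  "(real \<Rightarrow> real) \<Rightarrow> (real \<Rightarrow> real) \<Rightarrow> (real \<Rightarrow> real) \<Rightarrow> real \<Rightarrow> real \<Rightarrow> real" where
  "b_rate S \<phi> \<psi> z y =
     (\<phi> (z - y) * left_scale_deriv S \<psi> z - left_scale_deriv S \<phi> z * \<psi> (z - y)) /
     (\<phi> (z - y) * \<psi> z - \<phi> z * \<psi> (z - y))"

text \<open>
  The number \<open>x \<or> (y + l)\<close>. In \<open>ereal\<close>, \<open>y + l = - \<infinity>\<close> if \<open>l = - \<infinity>\<close>, so it is then equal to \<open>x\<close>.
\<close>

definition start_level :: "ereal \<Rightarrow> real \<Rightarrow> real \<Rightarrow> real" where
  "start_level l x y = real_of_ereal (max (ereal x) (ereal y + l))"

text \<open>
  The Stieltjes measure \<open>dS\<close> on \<open>{a..b}\<close>. The function \<open>S\<close> is made constant outside \<open>{a..b}\<close> because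
  \<open>interval_measure\<close> needs a function that is monotone on the whole real line.
\<close>

definition dS_measure :: "(real \<Rightarrow> real) \<Rightarrow> real \<Rightarrow> real \<Rightarrow> real measure" where
  "dS_measure S a b = interval_measure (\<lambda>z. S (max a (min b z)))"

end

theory Submission
  imports Defs
begin

text \<open>
  Let \<open>g(u,v)\<close> denote the expectation of \<open>exp (- \<alpha> H\<^sub>v)\<close> on the event that no fall of size \<open>y\<close> occurs before
  \<open>H\<^sub>v\<close>, for a path started at \<open>u \<le> v\<close>. At time \<open>H\<^sub>v\<close> the path is at its running maximum, so falls that
  start earlier do not matter for the future, and the strong Markov property gives
  \<open>g(u,w) = g(u,v) g(v,w)\<close> (\<open>no_drop_transform_mult\<close>). Hence \<open>- ln g(a, \<cdot>)\<close> is additive over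
  levels, and the theorem says that it grows at rate \<open>b_rate\<close> with respect to the scale.

  The rate comes from short steps. While the path climbs from \<open>u\<close> to \<open>v\<close>, its maximum lies between \<open>u\<close> and \<open>v\<close>.
  It is therefore enough that the path avoids \<open>v - y\<close>, and necessary that it avoids \<open>u - y\<close>
  (\<open>no_drop_transform_ge_exit\<close>, \<open>no_drop_transform_le_exit\<close>). Both are two-sided exit problems, and with
  \<open>W\<^sub>c(z) = \<phi>(c) \<psi>(z) - \<psi>(c) \<phi>(z)\<close> the transform for leaving the interval from \<open>c\<close> to \<open>v\<close> at \<open>v\<close> is
  \<open>W\<^sub>c(u) / W\<^sub>c(v)\<close> (\<open>exit_transform_formula\<close>). As \<open>u\<close> increases to \<open>v\<close>, the two bounds have the same
  logarithmic left derivative, that of \<open>W\<^sub>c\<close> at \<open>v\<close> with \<open>c = v - y\<close>, which is \<open>b_rate\<close>. A continuous function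
  is the integral of its left derivative with respect to the scale if that derivative is continuous and
  bounded (\<open>left_scale_deriv_imp_integral\<close>), and this yields the exponential
  (\<open>exit_squeeze_exponential\<close>).

  Below the level \<open>y + l\<close> a fall of size \<open>y\<close> is impossible because the path does not go below \<open>l\<close>. The passage
  from \<open>x\<close> to the start level therefore only contributes the hitting time transform
  \<open>\<psi>(x) / \<psi>(x \<or> (y + l))\<close> (\<open>no_drop_transform_near_boundary\<close>).

  The probabilistic work is in the measurability. The strong Markov property concerns events of a
  product sigma-algebra on paths, whereas hitting times and falls depend on uncountably many times. Continuity
  reduces them to countably many, first for events in the past of a hitting time, and then, by applying the same
  lemmas to the coordinate process on the space of continuous paths, for functionals of the future.
\<close>

section \<open>Paths that may explode\<close>

text \<open>
  The sample paths of the diffusion as seen by a single \<open>\<omega>\<close>. Stating this for a pair \<open>X\<close>, \<open>\<omega>\<close>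
  instead of a function of time lets the same lemmas serve the diffusion and the coordinate process.
\<close>

definition explosive_path :: "(real \<Rightarrow> 'w \<Rightarrow> ereal) \<Rightarrow> 'w \<Rightarrow> bool" where
  "explosive_path X \<omega> \<longleftrightarrow> continuous_on {0..} (\<lambda>t. X t \<omega>) \<and> (\<forall>t\<ge>0. X t \<omega> \<noteq> - \<infinity>) \<and>
     (\<forall>s t. 0 \<le> s \<longrightarrow> s \<le> t \<longrightarrow> X s \<omega> = \<infinity> \<longrightarrow> X t \<omega> = \<infinity>)"

text \<open>
  The event that the maximum decrease up to \<open>h\<close> is below \<open>y\<close>, without suprema: no two ordered times
  up to \<open>h\<close> see a fall of \<open>y\<close> or more. In this form it splits at an intermediate time and is tested
  by countably many times.
\<close>

definition no_drop :: "(real \<Rightarrow> 'w \<Rightarrow> ereal) \<Rightarrow> real \<Rightarrow> real \<Rightarrow> 'w \<Rightarrow> bool" where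
  "no_drop X y h \<omega> \<longleftrightarrow> (\<forall>s t. 0 \<le> s \<longrightarrow> s \<le> t \<longrightarrow> t \<le> h \<longrightarrow> X s \<omega> < X t \<omega> + ereal y)"

abbreviation (input) coord :: "real \<Rightarrow> (real \<Rightarrow> ereal) \<Rightarrow> ereal" where
  "coord \<equiv> \<lambda>t w. w t"

lemma explosive_path_shift:
  assumes "explosive_path X \<omega>" "0 \<le> s"
  shows "explosive_path coord (path_from X s \<omega>)"
proof -
  have "continuous_on {0..} (\<lambda>t. X (s + t) \<omega>)"
    by (rule continuous_on_compose2[where g = "\<lambda>t. X t \<omega>" and t = "{0..}"])
      (use assms in \<open>auto simp: explosive_path_def intro!: continuous_intros\<close>)
  then have "continuous_on {0..} (path_from X s \<omega>)"
    by (rule continuous_on_eq) (auto simp: path_from_def)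
  moreover have "X (s + t) \<omega> = \<infinity>" if "0 \<le> r" "r \<le> t" "X (s + r) \<omega> = \<infinity>" for r t
  proof -
    have "0 \<le> s + r" "s + r \<le> s + t" using assms(2) that by auto
    then show ?thesis using assms(1) that(3) unfolding explosive_path_def by blast
  qed
  ultimately show ?thesis
    using assms unfolding explosive_path_def by (auto simp: path_from_def)
qed

lemma hit_path_from_0: "hit coord v (path_from X 0 \<omega>) = hit X v \<omega>"
  unfolding hit_def path_from_def by (rule arg_cong[where f = Inf]) auto

lemma hit_le: "0 \<le> t \<Longrightarrow> X t \<omega> = ereal v \<Longrightarrow> hit X v \<omega> \<le> ennreal t"
  unfolding hit_def by (rule INF_lower) auto

lemma closed_level_times:
  assumes "explosive_path X \<omega>"
  shows "closed {t. 0 \<le> t \<and> X t \<omega> = ereal v}"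
proof -
  have "closed ({0..} \<inter> (\<lambda>t. X t \<omega>) -` {ereal v})"
    using assms by (intro continuous_closed_preimage) (auto simp: explosive_path_def)
  moreover have "{0..} \<inter> (\<lambda>t. X t \<omega>) -` {ereal v} = {t. 0 \<le> t \<and> X t \<omega> = ereal v}" by auto
  ultimately show ?thesis by simp
qed

text \<open>
  The infimum over the hitting times is a minimum, because the level sets of a continuous path are closed.
\<close>

lemma hit_attained:
  assumes "explosive_path X \<omega>" "hit X v \<omega> < \<infinity>"
  shows "X (enn2real (hit X v \<omega>)) \<omega> = ereal v"
proof -
  let ?A = "{t. 0 \<le> t \<and> X t \<omega> = ereal v}"
  have ne: "?A \<noteq> {}"
    using assms(2) unfolding hit_def by (metis INF_empty less_irrefl infinity_ennreal_def)
  have bdd: "bdd_below ?A" by (intro bdd_belowI[of _ 0]) auto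
  have mem: "Inf ?A \<in> ?A"
    using closed_contains_Inf[OF ne bdd closed_level_times[OF assms(1)]] .
  have "hit X v \<omega> = ennreal (Inf ?A)"
  proof (rule antisym)
    show "hit X v \<omega> \<le> ennreal (Inf ?A)" using mem by (intro hit_le) auto
    show "ennreal (Inf ?A) \<le> hit X v \<omega>"
      unfolding hit_def by (intro INF_greatest ennreal_leI cInf_lower bdd)
  qed
  moreover have "0 \<le> Inf ?A" using mem by blast
  ultimately show ?thesis using mem by simp
qed

lemma hit_le_iff:
  assumes "explosive_path X \<omega>" "0 \<le> q"
  shows "hit X v \<omega> \<le> ennreal q \<longleftrightarrow> (\<exists>s\<in>{0..q}. X s \<omega> = ereal v)"
proof
  assume le: "hit X v \<omega> \<le> ennreal q"
  then have fin: "hit X v \<omega> < \<infinity>" using le_less_trans ennreal_less_top by (simp add: le_less_trans)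
  have "enn2real (hit X v \<omega>) \<le> q" using enn2real_mono[OF le] assms(2) by simp
  then show "\<exists>s\<in>{0..q}. X s \<omega> = ereal v"
    using hit_attained[OF assms(1) fin] by (intro bexI[of _ "enn2real (hit X v \<omega>)"]) auto
next
  assume "\<exists>s\<in>{0..q}. X s \<omega> = ereal v"
  then obtain s where s: "0 \<le> s" "s \<le> q" "X s \<omega> = ereal v" by auto
  have "hit X v \<omega> \<le> ennreal s" by (rule hit_le) (use s in auto)
  also have "\<dots> \<le> ennreal q" using s by (simp add: ennreal_leI)
  finally show "hit X v \<omega> \<le> ennreal q" .
qed

text \<open>
  By the intermediate value theorem a path started below a level stays there until it hits it.
\<close>

lemma path_le_level:
  assumes p: "explosive_path X \<omega>" and "X 0 \<omega> \<le> ereal v" "0 \<le> t" "ennreal t \<le> hit X v \<omega>"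
  shows "X t \<omega> \<le> ereal v"
proof (rule ccontr)
  assume n: "\<not> X t \<omega> \<le> ereal v"
  have "continuous_on {0..t} (\<lambda>t. X t \<omega>)"
    using p by (auto simp: explosive_path_def intro: continuous_on_subset)
  then obtain s where s: "0 \<le> s" "s \<le> t" "X s \<omega> = ereal v"
    using IVT'[of "\<lambda>t. X t \<omega>" 0 "ereal v" t] assms n by (auto simp: not_le dest: less_imp_le)
  have "ennreal t \<le> ennreal s" using order_trans[OF assms(4) hit_le[of s X \<omega> v]] s by simp
  then have "t = s" using s by simp
  then show False using s n by simp
qed

lemma path_ge_level:
  assumes p: "explosive_path X \<omega>" and "ereal v \<le> X 0 \<omega>" "0 \<le> t" "ennreal t \<le> hit X v \<omega>"
  shows "ereal v \<le> X t \<omega>"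
proof (rule ccontr)
  assume n: "\<not> ereal v \<le> X t \<omega>"
  have "continuous_on {0..t} (\<lambda>t. X t \<omega>)"
    using p by (auto simp: explosive_path_def intro: continuous_on_subset)
  then obtain s where s: "0 \<le> s" "s \<le> t" "X s \<omega> = ereal v"
    using IVT2'[of "\<lambda>t. X t \<omega>" t "ereal v" 0] assms n by (auto simp: not_le dest: less_imp_le)
  have "ennreal t \<le> ennreal s" using order_trans[OF assms(4) hit_le[of s X \<omega> v]] s by simp
  then have "t = s" using s by simp
  then show False using s n by simp
qed

text \<open>
  This is what makes hitting times functionals of the shifted path, and hence accessible to the strong Markov property.
\<close>

lemma hit_shift:
  assumes p: "explosive_path X \<omega>" and T: "0 \<le> T" "ennreal T \<le> hit X v \<omega>"
  shows "hit X v \<omega> = ennreal T + hit coord v (path_from X T \<omega>)"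
proof (rule antisym)
  show "hit X v \<omega> \<le> ennreal T + hit coord v (path_from X T \<omega>)"
  proof (cases "hit coord v (path_from X T \<omega>) < \<infinity>")
    case True
    define t where "t = enn2real (hit coord v (path_from X T \<omega>))"
    have t: "0 \<le> t" "hit coord v (path_from X T \<omega>) = ennreal t"
      using True by (auto simp: t_def)
    have "path_from X T \<omega> t = ereal v"
      using hit_attained[of coord "path_from X T \<omega>" v] explosive_path_shift[OF p T(1)] True t by simp
    then have "X (T + t) \<omega> = ereal v" using t by (simp add: path_from_def)
    then have "hit X v \<omega> \<le> ennreal (T + t)" using T t by (intro hit_le) auto
    then show ?thesis using T t by simp
  qed (auto simp: less_top[symmetric])
  show "ennreal T + hit coord v (path_from X T \<omega>) \<le> hit X v \<omega>"
    unfolding hit_def[of X]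
  proof (rule INF_greatest)
    fix t assume "t \<in> {t. 0 \<le> t \<and> X t \<omega> = ereal v}"
    then have t: "0 \<le> t" "X t \<omega> = ereal v" by auto
    have "ennreal T \<le> ennreal t" using order_trans[OF T(2) hit_le[of t X \<omega> v]] t by simp
    then have le: "T \<le> t" using t by simp
    have "hit coord v (path_from X T \<omega>) \<le> ennreal (t - T)"
      using le t by (intro hit_le) (auto simp: path_from_def)
    then have "ennreal T + hit coord v (path_from X T \<omega>) \<le> ennreal T + ennreal (t - T)"
      by (rule add_left_mono)
    also have "\<dots> = ennreal t" using T le by (simp flip: ennreal_plus)
    finally show "ennreal T + hit coord v (path_from X T \<omega>) \<le> ennreal t" .
  qed
qed

lemma discount_nonneg: "0 \<le> discount \<alpha> T" by (simp add: discount_def)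

lemma discount_le_1: "0 < \<alpha> \<Longrightarrow> discount \<alpha> T \<le> 1"
  by (simp add: discount_def)

lemma discount_add:
  assumes "0 \<le> T" shows "discount \<alpha> (ennreal T + H) = exp (- \<alpha> * T) * discount \<alpha> H"
proof (cases H)
  case (real h)
  then have "ennreal T + H = ennreal (T + h)" using assms by simp
  then show ?thesis using assms real
    by (simp add: discount_def ring_distribs exp_add exp_diff exp_minus field_simps del: ennreal_plus)
qed (simp add: discount_def)

lemma path_finite_before:
  assumes p: "explosive_path X \<omega>" and "X h \<omega> < \<infinity>" "0 \<le> s" "s \<le> h"
  shows "\<bar>X s \<omega>\<bar> \<noteq> \<infinity>"
proof -
  have "X s \<omega> \<noteq> \<infinity>" using assms unfolding explosive_path_def by (metis less_irrefl)
  moreover have "X s \<omega> \<noteq> - \<infinity>" using assms unfolding explosive_path_def by blast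
  ultimately show ?thesis by auto
qed

text \<open>
  The fall \<open>X s - X t\<close> is continuous on the compact triangle \<open>s \<le> t \<le> h\<close> and attains its maximum,
  so a strict bound leaves room to spare. The finite value at \<open>h\<close> excludes an explosion before \<open>h\<close>.
\<close>

lemma no_drop_uniform:
  assumes p: "explosive_path X \<omega>" and fin: "X h \<omega> < \<infinity>" and h: "0 \<le> h"
    and nd: "no_drop X y h \<omega>"
  shows "\<exists>C<y. \<forall>s t. 0 \<le> s \<longrightarrow> s \<le> t \<longrightarrow> t \<le> h \<longrightarrow> X s \<omega> \<le> X t \<omega> + ereal C"
proof -
  define w where "w t = real_of_ereal (X t \<omega>)" for t
  have w: "X t \<omega> = ereal (w t)" if "0 \<le> t" "t \<le> h" for t
    using path_finite_before[OF p fin that] by (simp add: w_def ereal_real')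
  have "continuous_on {0..h} (\<lambda>t. X t \<omega>)"
    using p by (auto simp: explosive_path_def intro: continuous_on_subset)
  then have "continuous_on {0..h} (\<lambda>t. ereal (w t))"
    by (rule continuous_on_eq) (simp add: w)
  then have cw: "continuous_on {0..h} w"
    by (simp add: continuous_on_def)
  let ?K = "{z \<in> {0..h} \<times> {0..h}. fst z \<le> snd z}"
  have "closed {z :: real \<times> real. fst z \<le> snd z}"
    by (intro closed_Collect_le continuous_intros)
  then have "compact (({0..h} \<times> {0..h}) \<inter> {z :: real \<times> real. fst z \<le> snd z})"
    by (intro compact_Int_closed compact_Times) auto
  moreover have "({0..h} \<times> {0..h}) \<inter> {z :: real \<times> real. fst z \<le> snd z} = ?K" by auto
  ultimately have "compact ?K" by simp
  moreover have "(0,0) \<in> ?K" using h by auto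
  moreover have "continuous_on ?K (\<lambda>z. w (fst z) - w (snd z))"
    by (intro continuous_intros continuous_on_compose2[OF cw]) auto
  ultimately obtain z where z: "z \<in> ?K" and zmax: "\<forall>z'\<in>?K. w (fst z') - w (snd z') \<le> w (fst z) - w (snd z)"
    using continuous_attains_sup[of ?K "\<lambda>z. w (fst z) - w (snd z)"] by blast
  define C where "C = w (fst z) - w (snd z)"
  have "X (fst z) \<omega> < X (snd z) \<omega> + ereal y" using nd z by (auto simp: no_drop_def)
  then have "C < y" using z by (auto simp: w C_def)
  moreover have "X s \<omega> \<le> X t \<omega> + ereal C" if "0 \<le> s" "s \<le> t" "t \<le> h" for s t
    using that zmax[rule_format, of "(s,t)"] by (auto simp: w C_def)
  ultimately show ?thesis by blast
qed

text \<open>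
  The strict bound survives the suprema because of the room to spare in \<open>no_drop_uniform\<close>.
\<close>

lemma max_decrease_less_iff_no_drop:
  assumes p: "explosive_path X \<omega>" and fin: "X h \<omega> < \<infinity>" and h: "0 \<le> h"
  shows "max_decrease X h \<omega> < ereal y \<longleftrightarrow> no_drop X y h \<omega>"
proof
  assume less: "max_decrease X h \<omega> < ereal y"
  show "no_drop X y h \<omega>" unfolding no_drop_def
  proof (intro allI impI)
    fix s t assume st: "0 \<le> s" "s \<le> t" "t \<le> h"
    have f: "\<bar>X s \<omega>\<bar> \<noteq> \<infinity>" "\<bar>X t \<omega>\<bar> \<noteq> \<infinity>" using path_finite_before[OF p fin] st by auto
    have "X s \<omega> \<le> running_max X t \<omega>"
      unfolding running_max_def using st by (intro SUP_upper) auto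
    then have "X s \<omega> - X t \<omega> \<le> running_max X t \<omega> - X t \<omega>" by (rule ereal_minus_mono) simp
    also have "\<dots> \<le> max_decrease X h \<omega>"
      unfolding max_decrease_def using st by (intro SUP_upper) auto
    also note less
    finally show "X s \<omega> < X t \<omega> + ereal y" using f
      by (cases "X s \<omega>"; cases "X t \<omega>") auto
  qed
next
  assume "no_drop X y h \<omega>"
  then obtain C where C: "C < y" "\<And>s t. 0 \<le> s \<Longrightarrow> s \<le> t \<Longrightarrow> t \<le> h \<Longrightarrow> X s \<omega> \<le> X t \<omega> + ereal C"
    using no_drop_uniform[OF p fin h] by blast
  have "max_decrease X h \<omega> \<le> ereal C"
    unfolding max_decrease_def
  proof (rule SUP_least)
    fix t assume t: "t \<in> {0..h}"
    have "running_max X t \<omega> \<le> X t \<omega> + ereal C"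
      unfolding running_max_def using t C(2) by (intro SUP_least) auto
    then show "running_max X t \<omega> - X t \<omega> \<le> ereal C"
      using path_finite_before[OF p fin, of t] t by (simp add: ereal_minus_le add.commute)
  qed
  then show "max_decrease X h \<omega> < ereal y"
    using C(1) by (meson le_less_trans less_ereal.simps(1))
qed

text \<open>
  Any fall of more than \<open>c\<close> from \<open>s\<close> to \<open>t\<close> persists when \<open>s\<close> is moved slightly to the right and \<open>t\<close>
  slightly to the left, so rational times before \<open>h\<close> detect it. The times \<open>b < h\<close> are strictly
  before \<open>h\<close> so that the event can be decided by the past of a hitting time \<open>h\<close>.
\<close>

lemma no_drop_iff_rational:
  assumes p: "explosive_path X \<omega>" and fin: "X h \<omega> < \<infinity>" and h: "0 \<le> h" and y: "0 < y"
  shows "no_drop X y h \<omega> \<longleftrightarrow>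
    (\<exists>k. \<forall>a\<in>\<rat>. \<forall>b\<in>\<rat>. 0 \<le> a \<longrightarrow> a \<le> b \<longrightarrow> b < h \<longrightarrow> X a \<omega> \<le> X b \<omega> + ereal (y - 1 / real (Suc k)))"
proof
  assume "no_drop X y h \<omega>"
  then obtain C where C: "C < y" "\<And>s t. 0 \<le> s \<Longrightarrow> s \<le> t \<Longrightarrow> t \<le> h \<Longrightarrow> X s \<omega> \<le> X t \<omega> + ereal C"
    using no_drop_uniform[OF p fin h] by blast
  obtain k where "1 / real (Suc k) < y - C"
    using C(1) reals_Archimedean[of "y - C"] by (auto simp: inverse_eq_divide)
  then have "X a \<omega> \<le> X b \<omega> + ereal (y - 1 / real (Suc k))" if "0 \<le> a" "a \<le> b" "b < h" for a b
    using order_trans[OF C(2)[of a b] add_left_mono[of "ereal C" "ereal (y - 1 / real (Suc k))"]] that by auto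
  then show "\<exists>k. \<forall>a\<in>\<rat>. \<forall>b\<in>\<rat>. 0 \<le> a \<longrightarrow> a \<le> b \<longrightarrow> b < h \<longrightarrow> X a \<omega> \<le> X b \<omega> + ereal (y - 1 / real (Suc k))"
    by blast
next
  assume "\<exists>k. \<forall>a\<in>\<rat>. \<forall>b\<in>\<rat>. 0 \<le> a \<longrightarrow> a \<le> b \<longrightarrow> b < h \<longrightarrow> X a \<omega> \<le> X b \<omega> + ereal (y - 1 / real (Suc k))"
  then obtain k where k: "\<And>a b. a \<in> \<rat> \<Longrightarrow> b \<in> \<rat> \<Longrightarrow> 0 \<le> a \<Longrightarrow> a \<le> b \<Longrightarrow> b < h \<Longrightarrow>
      X a \<omega> \<le> X b \<omega> + ereal (y - 1 / real (Suc k))" by blast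
  define c where "c = y - 1 / real (Suc k)"
  have "c < y" by (simp add: c_def)
  show "no_drop X y h \<omega>" unfolding no_drop_def
  proof (intro allI impI)
    fix s t assume st: "0 \<le> s" "s \<le> t" "t \<le> h"
    obtain xs where xs: "X s \<omega> = ereal xs" using path_finite_before[OF p fin, of s] st by (cases "X s \<omega>") auto
    obtain xt where xt: "X t \<omega> = ereal xt" using path_finite_before[OF p fin, of t] st by (cases "X t \<omega>") auto
    show "X s \<omega> < X t \<omega> + ereal y"
    proof (cases "s = t")
      case True then show ?thesis using y xs by simp
    next
      case False
      then have less: "s < t" using st by simp
      have "xs \<le> xt + c"
      proof (rule ccontr)
        assume "\<not> xs \<le> xt + c"
        then obtain r where r: "xt + c < r" "r < xs" using dense by (meson not_le)
        have c0: "continuous_on {0..} (\<lambda>t. X t \<omega>)" using p by (simp add: explosive_path_def)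
        have cs: "((\<lambda>t. X t \<omega>) \<longlongrightarrow> X s \<omega>) (at_right s)"
          using c0 st by (auto simp: continuous_on_def intro: tendsto_within_subset)
        have "((\<lambda>t. X t \<omega>) \<longlongrightarrow> X t \<omega>) (at t within {0..})"
          using c0 st by (auto simp: continuous_on_def)
        then have ct: "((\<lambda>t. X t \<omega>) \<longlongrightarrow> X t \<omega>) (at t within {0..t})"
          by (rule tendsto_within_subset) auto
        have es: "\<forall>\<^sub>F a in at_right s. ereal r < X a \<omega>"
          using order_tendstoD(1)[OF cs, of "ereal r"] r xs by simp
        have et: "\<forall>\<^sub>F b in at_left t. X b \<omega> < ereal (r - c) \<and> b < t"
        proof -
          have "((\<lambda>t. X t \<omega>) \<longlongrightarrow> X t \<omega>) (at_left t)"
            using ct less st at_within_Icc_at_left[of 0 t] by simp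
          from order_tendstoD(2)[OF this, of "ereal (r - c)"] show ?thesis
            using r xt by (auto intro!: eventually_conj simp: eventually_at_left_field)
        qed
        obtain s' where s': "s < s'" "\<And>a. s < a \<Longrightarrow> a < s' \<Longrightarrow> ereal r < X a \<omega>"
          using es by (auto simp: eventually_at_right_field)
        obtain t' where t': "t' < t" "\<And>b. t' < b \<Longrightarrow> b < t \<Longrightarrow> X b \<omega> < ereal (r - c)"
          using et by (auto simp: eventually_at_left_field)
        obtain a where a: "a \<in> \<rat>" "s < a" "a < min s' t" using Rats_dense_in_real[of s "min s' t"] s' less by auto
        obtain b where b: "b \<in> \<rat>" "max a t' < b" "b < t" using Rats_dense_in_real[of "max a t'" t] t' a by auto
        have "ereal r < X a \<omega>" using s' a by auto
        also have "\<dots> \<le> X b \<omega> + ereal c" unfolding c_def using k[of a b] a b st by auto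
        finally have "ereal r < X b \<omega> + ereal c" .
        moreover have "X b \<omega> < ereal (r - c)" using t' b by auto
        ultimately show False by (cases "X b \<omega>") auto
      qed
      then show ?thesis using \<open>c < y\<close> xs xt by simp
    qed
  qed
qed

text \<open>
  At \<open>T = hit X v\<close> the path is at its running maximum \<open>v\<close>. A fall that starts before \<open>T\<close> and ends after
  \<open>T\<close> is therefore at most as large as the one that starts at \<open>T\<close>, and the two parts of the path
  can be tested separately.
\<close>

lemma no_drop_concat:
  assumes p: "explosive_path X \<omega>" and start: "X 0 \<omega> \<le> ereal v"
    and T: "0 \<le> T" "hit X v \<omega> = ennreal T" and h: "0 \<le> h"
  shows "no_drop X y (T + h) \<omega> \<longleftrightarrow> no_drop X y T \<omega> \<and> no_drop coord y h (path_from X T \<omega>)"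
proof (intro iffI conjI)
  assume a: "no_drop X y (T + h) \<omega>"
  show "no_drop X y T \<omega>" using a h unfolding no_drop_def by auto
  show "no_drop coord y h (path_from X T \<omega>)" using a T unfolding no_drop_def path_from_def by auto
next
  assume a: "no_drop X y T \<omega> \<and> no_drop coord y h (path_from X T \<omega>)"
  have after: "X s \<omega> < X t \<omega> + ereal y" if "T \<le> s" "s \<le> t" "t \<le> T + h" for s t
    using a[THEN conjunct2, unfolded no_drop_def, rule_format, of "s - T" "t - T"] that
    by (auto simp: path_from_def)
  have XT: "X T \<omega> = ereal v" using hit_attained[OF p, of v] T by simp
  show "no_drop X y (T + h) \<omega>" unfolding no_drop_def
  proof (intro allI impI)
    fix s t assume st: "0 \<le> s" "s \<le> t" "t \<le> T + h"
    consider "t \<le> T" | "T \<le> s" | "s \<le> T" "T \<le> t" by linarith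
    then show "X s \<omega> < X t \<omega> + ereal y"
    proof cases
      case 1 then show ?thesis using a st by (auto simp: no_drop_def)
    next
      case 2 then show ?thesis using after st by auto
    next
      case 3
      have "X s \<omega> \<le> X T \<omega>"
        using path_le_level[OF p start, of s] st 3 T XT by (simp add: ennreal_leI)
      also have "\<dots> < X t \<omega> + ereal y" using after[of T t] 3 st by auto
      finally show ?thesis .
    qed
  qed
qed


section \<open>Hitting times and drawdown events in the past\<close>

text \<open>
  Only path regularity and measurability are used for the measurability of hitting times and
  drawdown events. The diffusion is one instance; the coordinate process on \<open>explosive_paths\<close> is the
  other, and it turns these events into measurable functionals of the path.
\<close>

locale continuous_process =
  fixes M :: "'w measure" and X :: "real \<Rightarrow> 'w \<Rightarrow> ereal"
  assumes measurable_X [measurable]: "\<And>t. 0 \<le> t \<Longrightarrow> X t \<in> borel_measurable M"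
    and explosive: "\<And>\<omega>. \<omega> \<in> space M \<Longrightarrow> explosive_path X \<omega>"
begin

text \<open>
  The past as a measure, for the sake of the measurability prover.
\<close>

definition past_algebra :: "real \<Rightarrow> 'w measure" where
  "past_algebra t = sigma (space M) {X s -` B \<inter> space M | s B. 0 \<le> s \<and> s \<le> t \<and> B \<in> sets borel}"

lemma space_past_algebra [simp]: "space (past_algebra t) = space M"
  unfolding past_algebra_def by (subst space_measure_of) auto

lemma sets_past_algebra: "sets (past_algebra t) = past M X t"
  unfolding past_algebra_def past_def by (subst sets_measure_of) auto

lemma measurable_past [measurable]:
  assumes "0 \<le> s" "s \<le> t" shows "X s \<in> borel_measurable (past_algebra t)"
proof (rule measurableI)
  fix B :: "ereal set" assume "B \<in> sets borel"
  then show "X s -` B \<inter> space (past_algebra t) \<in> sets (past_algebra t)"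
    using assms unfolding sets_past_algebra past_def space_past_algebra
    by (intro sigma_sets.Basic) auto
qed auto

lemma past_subset: "past M X t \<subseteq> sets M"
  unfolding past_def using measurable_sets[OF measurable_X]
  by (intro sets.sigma_sets_subset) auto

text \<open>
  By compactness of \<open>{0..q}\<close> the level \<open>v\<close> is reached by time \<open>q\<close> as soon as the path comes arbitrarily
  close to it, and by continuity a countable dense set of times suffices to see this.
\<close>

lemma hit_le_past:
  assumes q: "0 \<le> q" "q \<le> t"
  shows "{\<omega>\<in>space M. hit X v \<omega> \<le> ennreal q} \<in> past M X t"
proof -
  obtain D where D: "countable D" "D \<subseteq> {0..q}" "{0..q} \<subseteq> closure D"
    using separable[of "{0..q}"] by blast
  have "hit X v \<omega> \<le> ennreal q \<longleftrightarrow> (\<forall>n. \<exists>s\<in>D. X s \<omega> \<in> ereal ` ball v (1 / real (Suc n)))"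
    if \<omega>: "\<omega> \<in> space M" for \<omega>
  proof -
    note p = explosive[OF \<omega>]
    have c: "continuous_on {0..q} (\<lambda>t. X t \<omega>)"
      using p by (auto simp: explosive_path_def intro: continuous_on_subset)
    show ?thesis unfolding hit_le_iff[OF p q(1)]
    proof (intro iffI allI)
      fix n assume "\<exists>s\<in>{0..q}. X s \<omega> = ereal v"
      then obtain s where s: "s \<in> {0..q}" "X s \<omega> = ereal v" by blast
      have "open (ereal ` ball v (1 / real (Suc n)))" by (intro open_ereal) auto
      moreover have "X s \<omega> \<in> ereal ` ball v (1 / real (Suc n))" using s by auto
      ultimately obtain V where V: "open V" "s \<in> V" "\<And>x. x \<in> {0..q} \<Longrightarrow> x \<in> V \<Longrightarrow> X x \<omega> \<in> ereal ` ball v (1 / real (Suc n))"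
        using c s(1) unfolding continuous_on_topological by metis
      have "V \<inter> D \<noteq> {}" using V s D(3) open_Int_closure_eq_empty[of V D] by blast
      then show "\<exists>s\<in>D. X s \<omega> \<in> ereal ` ball v (1 / real (Suc n))" using V D(2) by blast
    next
      assume A: "\<forall>n. \<exists>s\<in>D. X s \<omega> \<in> ereal ` ball v (1 / real (Suc n))"
      show "\<exists>s\<in>{0..q}. X s \<omega> = ereal v"
      proof (rule ccontr)
        assume n: "\<not> (\<exists>s\<in>{0..q}. X s \<omega> = ereal v)"
        let ?K = "(\<lambda>t. X t \<omega>) ` {0..q}"
        have "compact ?K" by (intro compact_continuous_image c) auto
        then have "open (- ?K)" by (simp add: compact_imp_closed open_Compl)
        then have "open (ereal -` (- ?K))" by (simp add: open_ereal_def)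
        moreover have "v \<in> ereal -` (- ?K)" using n by auto
        ultimately obtain e where e: "0 < e" "ball v e \<subseteq> ereal -` (- ?K)"
          by (meson open_contains_ball)
        obtain k where "1 / real (Suc k) < e"
          using e(1) reals_Archimedean[of e] by (auto simp: inverse_eq_divide)
        moreover obtain s where "s \<in> D" "X s \<omega> \<in> ereal ` ball v (1 / real (Suc k))" using A by blast
        ultimately obtain r where "s \<in> {0..q}" "X s \<omega> = ereal r" "r \<in> ball v e"
          using D(2) by auto
        moreover have "X s \<omega> \<in> ?K" using calculation(1) by blast
        ultimately show False using e(2) by auto
      qed
    qed
  qed
  then have "{\<omega>\<in>space M. hit X v \<omega> \<le> ennreal q} =
      {\<omega>\<in>space (past_algebra t). \<forall>n. \<exists>s\<in>D. X s \<omega> \<in> ereal ` ball v (1 / real (Suc n))}"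
    by auto
  also have "\<dots> \<in> sets (past_algebra t)"
  proof -
    have [measurable]: "ereal ` ball v (1 / real (Suc n)) \<in> sets borel" for n
      by (intro borel_open open_ereal) auto
    have [measurable]: "X s \<in> borel_measurable (past_algebra t)" if "s \<in> D" for s
      using that D(2) q by (intro measurable_past) auto
    show ?thesis using D(1)
      by (intro sets.sets_Collect_countable_All sets.sets_Collect_countable_Bex) measurable
  qed
  finally show ?thesis unfolding sets_past_algebra .
qed

lemma hit_less_iff:
  "hit X v \<omega> < ennreal t \<longleftrightarrow> (\<exists>q\<in>\<rat> \<inter> {0..<t}. hit X v \<omega> \<le> ennreal q)"
proof
  assume less: "hit X v \<omega> < ennreal t"
  then obtain h where h: "hit X v \<omega> = ennreal h" "0 \<le> h" by (cases "hit X v \<omega>") auto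
  then have "h < t" using less by (simp add: ennreal_less_iff)
  then obtain q where "q \<in> \<rat>" "h < q" "q < t" using Rats_dense_in_real by blast
  then show "\<exists>q\<in>\<rat> \<inter> {0..<t}. hit X v \<omega> \<le> ennreal q"
    using h by (intro bexI[of _ q]) (auto intro: ennreal_leI)
next
  assume "\<exists>q\<in>\<rat> \<inter> {0..<t}. hit X v \<omega> \<le> ennreal q"
  then obtain q where "0 \<le> q" "q < t" "hit X v \<omega> \<le> ennreal q" by auto
  then show "hit X v \<omega> < ennreal t" using le_less_trans ennreal_less_iff by blast
qed

lemma markov_time_hit: "markov_time M X (hit X v)"
  unfolding markov_time_def
proof (intro allI impI)
  fix t :: real
  have "{\<omega>\<in>space M. hit X v \<omega> < ennreal t} = (\<Union>q\<in>\<rat> \<inter> {0..<t}. {\<omega>\<in>space M. hit X v \<omega> \<le> ennreal q})"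
    unfolding hit_less_iff by auto
  also have "\<dots> \<in> past M X t"
    unfolding sets_past_algebra[symmetric]
    by (intro sets.countable_UN' countable_Int1 countable_rat)
      (auto simp: sets_past_algebra intro!: hit_le_past)
  finally show "{\<omega>\<in>space M. hit X v \<omega> < ennreal t} \<in> past M X t" .
qed

definition no_drop_event :: "real \<Rightarrow> real \<Rightarrow> 'w set" where
  "no_drop_event y v = {\<omega>\<in>space M. hit X v \<omega> < \<infinity> \<and> no_drop X y (enn2real (hit X v \<omega>)) \<omega>}"

text \<open>
  Up to time \<open>t\<close> one can check all pairs of rational times before \<open>t\<close>, exempting those that lie beyond
  the hitting time; whether \<open>b\<close> is such a time is known at time \<open>b\<close>.
\<close>

lemma no_drop_event_markov_past:
  assumes y: "0 < y"
  shows "no_drop_event y v \<in> markov_past M X (hit X v)"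
proof -
  let ?Q = "\<lambda>t. \<rat> \<inter> {0..<t}"
  have eq: "no_drop_event y v \<inter> {\<omega>\<in>space M. hit X v \<omega> < ennreal t} =
      {\<omega>\<in>space M. hit X v \<omega> < ennreal t} \<inter>
      (\<Union>k. \<Inter>a\<in>?Q t. \<Inter>b\<in>?Q t. {\<omega>\<in>space M. a \<le> b \<longrightarrow> hit X v \<omega> \<le> ennreal b \<or>
          X a \<omega> \<le> X b \<omega> + ereal (y - 1 / real (Suc k))})"
    (is "?L = ?R") if t: "0 < t" for t
  proof -
    have "\<omega> \<in> ?L \<longleftrightarrow> \<omega> \<in> ?R" if \<omega>: "\<omega> \<in> space M" and less: "hit X v \<omega> < ennreal t" for \<omega>
    proof -
      define h where "h = enn2real (hit X v \<omega>)"
      have h: "0 \<le> h" "hit X v \<omega> = ennreal h" using less by (cases "hit X v \<omega>", auto simp: h_def)+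
      have "h < t" using less h by (simp add: ennreal_less_iff)
      have "X h \<omega> < \<infinity>" using hit_attained[OF explosive[OF \<omega>], of v] h by simp
      note iff = no_drop_iff_rational[OF explosive[OF \<omega>] this h(1) y]
      have "\<omega> \<in> ?L \<longleftrightarrow> no_drop X y h \<omega>"
        using \<omega> less h by (auto simp: no_drop_event_def)
      also have "\<dots> \<longleftrightarrow> (\<exists>k. \<forall>a\<in>?Q t. \<forall>b\<in>?Q t. a \<le> b \<longrightarrow>
          h \<le> b \<or> X a \<omega> \<le> X b \<omega> + ereal (y - 1 / real (Suc k)))"
        unfolding iff
      proof (intro ex_cong1 iffI ballI impI)
        fix k a b assume *: "\<forall>a\<in>?Q t. \<forall>b\<in>?Q t. a \<le> b \<longrightarrow> h \<le> b \<or> X a \<omega> \<le> X b \<omega> + ereal (y - 1 / real (Suc k))"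
          and ab: "a \<in> \<rat>" "b \<in> \<rat>" "0 \<le> a" "a \<le> b" "b < h"
        have "a \<in> ?Q t" "b \<in> ?Q t" using ab \<open>h < t\<close> by auto
        then show "X a \<omega> \<le> X b \<omega> + ereal (y - 1 / real (Suc k))" using * ab by fastforce
      next
        fix k a b assume "\<forall>a\<in>\<rat>. \<forall>b\<in>\<rat>. 0 \<le> a \<longrightarrow> a \<le> b \<longrightarrow> b < h \<longrightarrow> X a \<omega> \<le> X b \<omega> + ereal (y - 1 / real (Suc k))"
          and "a \<in> ?Q t" "b \<in> ?Q t" "a \<le> b"
        then show "h \<le> b \<or> X a \<omega> \<le> X b \<omega> + ereal (y - 1 / real (Suc k))"
          by (cases "h \<le> b") auto
      qed
      also have "\<dots> \<longleftrightarrow> (\<exists>k. \<forall>a\<in>?Q t. \<forall>b\<in>?Q t. a \<le> b \<longrightarrow>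
          hit X v \<omega> \<le> ennreal b \<or> X a \<omega> \<le> X b \<omega> + ereal (y - 1 / real (Suc k)))"
        unfolding h(2) by (intro ex_cong1 ball_cong refl) (auto simp: ennreal_le_iff)
      also have "\<dots> \<longleftrightarrow> \<omega> \<in> ?R"
        using \<omega> less by (simp only: Int_iff UN_iff INT_iff mem_Collect_eq simp_thms bex_UNIV)
      finally show ?thesis .
    qed
    moreover have "\<omega> \<in> space M \<and> hit X v \<omega> < ennreal t" if "\<omega> \<in> ?L \<or> \<omega> \<in> ?R" for \<omega> using that by blast
    ultimately show ?thesis by blast
  qed
  have past: "no_drop_event y v \<inter> {\<omega>\<in>space M. hit X v \<omega> < ennreal t} \<in> past M X t" if t: "0 < t" for t
  proof -
    let ?S = "\<lambda>k a b. {\<omega>\<in>space M. a \<le> b \<longrightarrow> hit X v \<omega> \<le> ennreal b \<or>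
          X a \<omega> \<le> X b \<omega> + ereal (y - 1 / real (Suc k))}"
    have Q: "countable (?Q t)" "?Q t \<noteq> {}" using t countable_rat by auto
    have S: "?S k a b \<in> sets (past_algebra t)" if a: "a \<in> ?Q t" and b: "b \<in> ?Q t" for k a b
    proof -
      have [measurable]: "X a \<in> borel_measurable (past_algebra t)" "X b \<in> borel_measurable (past_algebra t)"
        using a b by (auto intro!: measurable_past)
      have "{\<omega>\<in>space (past_algebra t). X a \<omega> \<le> X b \<omega> + ereal (y - 1 / real (Suc k))} \<in> sets (past_algebra t)"
        by measurable
      moreover have "{\<omega>\<in>space (past_algebra t). hit X v \<omega> \<le> ennreal b} \<in> sets (past_algebra t)"
        using hit_le_past[of b t v] b by (simp add: sets_past_algebra)
      ultimately have "{\<omega>\<in>space (past_algebra t). a \<le> b \<longrightarrow> hit X v \<omega> \<le> ennreal b \<or>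
          X a \<omega> \<le> X b \<omega> + ereal (y - 1 / real (Suc k))} \<in> sets (past_algebra t)"
        by (intro sets.sets_Collect_imp sets.sets_Collect_disj sets.sets_Collect_const)
      then show ?thesis unfolding space_past_algebra .
    qed
    have "(\<Inter>a\<in>?Q t. \<Inter>b\<in>?Q t. ?S k a b) \<in> sets (past_algebra t)" for k
      by (intro sets.countable_INT'[OF Q] image_subsetI S)
    then have "(\<Union>k. \<Inter>a\<in>?Q t. \<Inter>b\<in>?Q t. ?S k a b) \<in> sets (past_algebra t)"
      by (intro sets.countable_UN image_subsetI)
    moreover have "{\<omega>\<in>space M. hit X v \<omega> < ennreal t} \<in> sets (past_algebra t)"
      using markov_time_hit t by (simp add: markov_time_def sets_past_algebra)
    ultimately show ?thesis unfolding eq[OF t] sets_past_algebra[symmetric] by (intro sets.Int)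
  qed
  have "no_drop_event y v = (\<Union>n::nat. no_drop_event y v \<inter> {\<omega>\<in>space M. hit X v \<omega> < ennreal (real (Suc n))})"
  proof safe
    fix \<omega> assume A: "\<omega> \<in> no_drop_event y v"
    then obtain h where h: "hit X v \<omega> = ennreal h" "0 \<le> h"
      unfolding no_drop_event_def by (cases "hit X v \<omega>") auto
    obtain n where "h < real (Suc n)" using reals_Archimedean2 by (metis less_trans lessI of_nat_less_iff)
    then show "\<omega> \<in> (\<Union>n::nat. no_drop_event y v \<inter> {\<omega>\<in>space M. hit X v \<omega> < ennreal (real (Suc n))})"
      using A h by (auto simp: ennreal_less_iff no_drop_event_def simp del: of_nat_Suc intro!: exI[of _ n])
  qed
  also have "\<dots> \<in> sets M"
  proof (intro sets.countable_UN image_subsetI)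
    fix n :: nat
    have "0 < real (Suc n)" by simp
    then show "no_drop_event y v \<inter> {\<omega>\<in>space M. hit X v \<omega> < ennreal (real (Suc n))} \<in> sets M"
      using past past_subset by blast
  qed
  finally show ?thesis using past unfolding markov_past_def by auto
qed

lemma markov_past_sets: "A \<in> markov_past M X T \<Longrightarrow> A \<in> sets M"
  by (simp add: markov_past_def)

lemma sigma_algebra_markov_past:
  assumes T: "markov_time M X T"
  shows "sigma_algebra (space M) (markov_past M X T)"
proof -
  have T': "{\<omega>\<in>space M. T \<omega> < ennreal t} \<in> sets (past_algebra t)" if "0 < t" for t
    using T that by (simp add: markov_time_def sets_past_algebra)
  have S: "A \<in> markov_past M X T \<longleftrightarrow>
      A \<in> sets M \<and> (\<forall>t>0. A \<inter> {\<omega>\<in>space M. T \<omega> < ennreal t} \<in> sets (past_algebra t))" for A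
    by (simp add: markov_past_def sets_past_algebra)
  show ?thesis
    unfolding sigma_algebra_iff2
  proof (intro conjI ballI allI impI)
    show "markov_past M X T \<subseteq> Pow (space M)"
      using sets.sets_into_space by (auto simp: markov_past_def)
    show "{} \<in> markov_past M X T" by (simp add: S)
  next
    fix A assume A: "A \<in> markov_past M X T"
    have "(space M - A) \<inter> {\<omega>\<in>space M. T \<omega> < ennreal t} =
        {\<omega>\<in>space M. T \<omega> < ennreal t} - A \<inter> {\<omega>\<in>space M. T \<omega> < ennreal t}" for t by auto
    then show "space M - A \<in> markov_past M X T" using A T' by (auto simp: S intro!: sets.Diff)
  next
    fix A :: "nat \<Rightarrow> 'w set" assume A: "range A \<subseteq> markov_past M X T"
    have "(\<Union>i. A i) \<inter> {\<omega>\<in>space M. T \<omega> < ennreal t} = (\<Union>i. A i \<inter> {\<omega>\<in>space M. T \<omega> < ennreal t})" for t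
      by auto
    moreover have A': "A i \<in> markov_past M X T" for i using A by auto
    moreover have "(\<Union>i. A i \<inter> {\<omega>\<in>space M. T \<omega> < ennreal t}) \<in> sets (past_algebra t)" if "0 < t" for t
      using A' that unfolding S by (intro sets.countable_UN) auto
    moreover have "(\<Union>i. A i) \<in> sets M" using A' unfolding S by (intro sets.countable_UN) auto
    ultimately show "(\<Union>i. A i) \<in> markov_past M X T" unfolding S by auto
  qed
qed

definition markov_algebra :: "('w \<Rightarrow> ennreal) \<Rightarrow> 'w measure" where
  "markov_algebra T = sigma (space M) (markov_past M X T)"

lemma space_markov_algebra [simp]: "space (markov_algebra T) = space M"
  by (simp add: markov_algebra_def space_measure_of_conv)

lemma sets_markov_algebra:
  assumes "markov_time M X T" shows "sets (markov_algebra T) = markov_past M X T"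
proof -
  interpret sigma_algebra "space M" "markov_past M X T" by (rule sigma_algebra_markov_past[OF assms])
  show ?thesis unfolding markov_algebra_def by (rule sets_measure_of_eq)
qed

lemma measurable_markov_time:
  assumes T: "markov_time M X T"
  shows "T \<in> borel_measurable (markov_algebra T)"
proof (rule borel_measurableI_less)
  fix y :: ennreal
  have fin: "{\<omega>\<in>space M. T \<omega> < ennreal t} \<in> sets (markov_algebra T)" if t: "0 < t" for t
    unfolding sets_markov_algebra[OF T] markov_past_def
  proof (intro CollectI conjI allI impI)
    show "{\<omega> \<in> space M. T \<omega> < ennreal t} \<in> sets M"
      using T t past_subset unfolding markov_time_def by blast
    fix s :: real assume s: "0 < s"
    have "{\<omega>\<in>space M. T \<omega> < ennreal t} \<inter> {\<omega>\<in>space M. T \<omega> < ennreal s} = {\<omega>\<in>space M. T \<omega> < ennreal (min s t)}"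
      using s t by (auto simp: min_def intro: less_le_trans ennreal_leI)
    moreover have "{\<omega>\<in>space M. T \<omega> < ennreal (min s t)} \<in> past M X (min s t)"
      using T s t unfolding markov_time_def by auto
    moreover have "past M X (min s t) \<subseteq> past M X s"
      unfolding past_def by (intro sigma_sets_mono') auto
    ultimately show "{\<omega>\<in>space M. T \<omega> < ennreal t} \<inter> {\<omega>\<in>space M. T \<omega> < ennreal s} \<in> past M X s" by auto
  qed
  consider "y = 0" | t where "y = ennreal t" "0 < t" | "y = \<infinity>"
    by (cases y) (auto simp: le_less)
  then show "{\<omega>\<in>space (markov_algebra T). T \<omega> < y} \<in> sets (markov_algebra T)"
  proof cases
    case 3
    have "{\<omega>\<in>space M. T \<omega> < y} = (\<Union>n::nat. {\<omega>\<in>space M. T \<omega> < ennreal (real (Suc n))})"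
    proof safe
      fix \<omega> assume "T \<omega> < y" and "\<omega> \<in> space M"
      moreover obtain h where h: "T \<omega> = ennreal h" "0 \<le> h" using calculation 3 by (cases "T \<omega>") auto
      moreover obtain n where "h < real (Suc n)" using reals_Archimedean2 by (metis less_trans lessI of_nat_less_iff)
      ultimately show "\<omega> \<in> (\<Union>n::nat. {\<omega>\<in>space M. T \<omega> < ennreal (real (Suc n))})"
        by (auto simp: ennreal_less_iff simp del: of_nat_Suc intro!: exI[of _ n])
    qed (use 3 in \<open>auto intro: less_trans ennreal_less_top\<close>)
    then show ?thesis using fin[of "real (Suc _)"] by (auto simp del: of_nat_Suc intro!: sets.countable_UN)
  qed (use fin in auto)
qed

lemma subalgebra_markov_algebra:
  assumes "markov_time M X T"
  shows "subalgebra M (markov_algebra T)"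
  using sets_markov_algebra[OF assms] markov_past_sets by (auto simp: subalgebra_def)

lemma measurable_hit [measurable]: "hit X v \<in> borel_measurable M"
  using measurable_from_subalg[OF subalgebra_markov_algebra measurable_markov_time] markov_time_hit by blast

text \<open>
  If \<open>c\<close> is hit before \<open>v\<close>, a rational time between the two hitting times witnesses it.
\<close>

lemma hit_first_markov_past:
  "{\<omega>\<in>space M. hit X c \<omega> < hit X v \<omega>} \<in> markov_past M X (hit X c)"
proof -
  have eq: "{\<omega>\<in>space M. hit X c \<omega> < hit X v \<omega>} \<inter> {\<omega>\<in>space M. hit X c \<omega> < ennreal t} =
      (\<Union>q\<in>\<rat> \<inter> {0..<t}. {\<omega>\<in>space M. hit X c \<omega> \<le> ennreal q} - {\<omega>\<in>space M. hit X v \<omega> \<le> ennreal q})"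
    (is "?L = ?R") for t
  proof safe
    fix \<omega> assume \<omega>: "\<omega> \<in> space M" and less: "hit X c \<omega> < hit X v \<omega>" "hit X c \<omega> < ennreal t"
    then obtain u where u: "hit X c \<omega> < ennreal u" "ennreal u \<le> hit X v \<omega>" "u \<le> t"
    proof (cases "hit X v \<omega> \<le> ennreal t")
      case True
      then show ?thesis using less that[of "enn2real (hit X v \<omega>)"]
        by (cases "hit X v \<omega>") (auto simp: ennreal_le_iff2 top_unique intro: less_imp_le)
    qed (use less that[of t] in auto)
    from u(1) obtain q where q: "q \<in> \<rat> \<inter> {0..<u}" "hit X c \<omega> \<le> ennreal q"
      unfolding hit_less_iff by blast
    then have "ennreal q < ennreal u" by (auto simp: ennreal_less_iff)
    then have "\<not> hit X v \<omega> \<le> ennreal q" using u(2) by auto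
    then show "\<omega> \<in> ?R" using q u \<omega> by auto
  next
    fix \<omega> q assume "hit X c \<omega> \<le> ennreal q" "\<not> hit X v \<omega> \<le> ennreal q"
    then show "hit X c \<omega> < hit X v \<omega>" by auto
  next
    fix \<omega> q assume "hit X c \<omega> \<le> ennreal q" "q \<in> \<rat>" "q \<in> {0..<t}"
    then show "hit X c \<omega> < ennreal t" unfolding hit_less_iff by auto
  qed
  have "{\<omega>\<in>space M. hit X c \<omega> < hit X v \<omega>} \<inter> {\<omega>\<in>space M. hit X c \<omega> < ennreal t} \<in> past M X t" for t
    unfolding eq sets_past_algebra[symmetric]
  proof (intro sets.countable_UN' countable_Int1 countable_rat image_subsetI sets.Diff)
    fix q assume "q \<in> \<rat> \<inter> {0..<t}"
    then show "{\<omega>\<in>space M. hit X c \<omega> \<le> ennreal q} \<in> sets (past_algebra t)"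
      "{\<omega>\<in>space M. hit X v \<omega> \<le> ennreal q} \<in> sets (past_algebra t)"
      by (auto simp: sets_past_algebra intro!: hit_le_past)
  qed
  then show ?thesis unfolding markov_past_def by auto
qed

lemma no_drop_event_sets [measurable]: "0 < y \<Longrightarrow> no_drop_event y v \<in> sets M"
  using no_drop_event_markov_past markov_past_sets by blast

text \<open>Joint measurability: the path is continuous in time, so a random time can be replaced by its
  discretisations from above.\<close>

lemma measurable_at_random_time:
  assumes T [measurable]: "T \<in> borel_measurable M" and T0: "\<And>\<omega>. \<omega> \<in> space M \<Longrightarrow> 0 \<le> T \<omega>"
  shows "(\<lambda>\<omega>. X (T \<omega>) \<omega>) \<in> borel_measurable M"
proof (rule borel_measurable_LIMSEQ_order)
  define R where "R n \<omega> = real (nat \<lceil>real (Suc n) * T \<omega>\<rceil>) / real (Suc n)" for n \<omega>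
  show "(\<lambda>n. X (R n \<omega>) \<omega>) \<longlonglongrightarrow> X (T \<omega>) \<omega>" if \<omega>: "\<omega> \<in> space M" for \<omega>
  proof -
    have R: "T \<omega> \<le> R n \<omega>" "R n \<omega> \<le> T \<omega> + 1 / real (Suc n)" for n
    proof -
      let ?m = "real (Suc n)"
      have m: "0 < ?m" by simp
      have R_eq: "R n \<omega> = real_of_int \<lceil>?m * T \<omega>\<rceil> / ?m"
        using T0[OF \<omega>] unfolding R_def by (simp add: mult_nonneg_nonneg del: of_nat_Suc)
      show "T \<omega> \<le> R n \<omega>" unfolding R_eq pos_le_divide_eq[OF m]
        using le_of_int_ceiling[of "?m * T \<omega>"] by (simp add: mult.commute del: of_nat_Suc)
      have "R n \<omega> \<le> (?m * T \<omega> + 1) / ?m" unfolding R_eq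
        by (intro divide_right_mono of_int_ceiling_le_add_one) simp
      also have "\<dots> = T \<omega> + 1 / ?m" using m by (simp add: add_divide_distrib del: of_nat_Suc)
      finally show "R n \<omega> \<le> T \<omega> + 1 / ?m" .
    qed
    have "(\<lambda>n. T \<omega> + 1 / real (Suc n)) \<longlonglongrightarrow> T \<omega> + 0"
      by (intro tendsto_intros LIMSEQ_Suc lim_1_over_n)
    then have "(\<lambda>n. R n \<omega>) \<longlonglongrightarrow> T \<omega>"
      using R tendsto_sandwich[of "\<lambda>_. T \<omega>" "\<lambda>n. R n \<omega>" sequentially "\<lambda>n. T \<omega> + 1 / real (Suc n)" "T \<omega>"]
      by (simp del: of_nat_Suc)
    moreover have "continuous_on {0..} (\<lambda>t. X t \<omega>)" using explosive[OF \<omega>] by (simp add: explosive_path_def)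
    moreover have "\<forall>\<^sub>F n in sequentially. R n \<omega> \<in> {0..}"
      using order_trans[OF T0[OF \<omega>] R(1)] by simp
    ultimately show ?thesis using T0[OF \<omega>]
      by (intro continuous_on_tendsto_compose[of "{0..}" "\<lambda>t. X t \<omega>"]) auto
  qed
  show "(\<lambda>\<omega>. X (R n \<omega>) \<omega>) \<in> borel_measurable M" for n
    unfolding R_def
    by (rule measurable_compose_countable[of "\<lambda>k \<omega>. X (real k / real (Suc n)) \<omega>"]) measurable
qed

end

text \<open>
  The product sigma-algebra of \<open>path_space\<close> contains no event that involves uncountably many times.
  Its trace on the continuous paths does contain the hitting and drawdown events.
\<close>

definition explosive_paths :: "(real \<Rightarrow> ereal) measure" where
  "explosive_paths = restrict_space path_space {w. explosive_path coord w}"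

interpretation paths: continuous_process explosive_paths coord
proof
  show "coord t \<in> borel_measurable explosive_paths" if "0 \<le> t" for t
    unfolding explosive_paths_def path_space_def
    by (intro measurable_restrict_space1 measurable_component_singleton) (use that in auto)
  show "explosive_path coord w" if "w \<in> space explosive_paths" for w
    using that by (simp add: explosive_paths_def space_restrict_space)
qed

lemma (in continuous_process) measurable_path_from:
  assumes T [measurable]: "T \<in> borel_measurable M" and T0: "\<And>\<omega>. \<omega> \<in> space M \<Longrightarrow> 0 \<le> T \<omega>"
  shows "(\<lambda>\<omega>. path_from X (T \<omega>) \<omega>) \<in> M \<rightarrow>\<^sub>M explosive_paths"
  unfolding explosive_paths_def
proof (rule measurable_restrict_space2)
  show "(\<lambda>\<omega>. path_from X (T \<omega>) \<omega>) \<in> space M \<rightarrow> {w. explosive_path coord w}"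
    using explosive_path_shift[OF explosive T0] by auto
  show "(\<lambda>\<omega>. path_from X (T \<omega>) \<omega>) \<in> M \<rightarrow>\<^sub>M path_space"
    unfolding path_space_def path_from_def
    by (intro measurable_restrict measurable_at_random_time) (use T0 in auto)
qed


section \<open>The strong Markov property at a hitting time\<close>

context regular_diffusion
begin

lemma explosive_sample_path: "\<omega> \<in> space M \<Longrightarrow> explosive_path X \<omega>"
  unfolding explosive_path_def
proof (intro conjI allI impI)
  fix t :: real assume "\<omega> \<in> space M" "0 \<le> t"
  then show "X t \<omega> \<noteq> - \<infinity>" using state_values[of t \<omega>] by auto
qed (use continuous absorbed in auto)

sublocale continuous_process M X
  by unfold_locales (use measurable_X explosive_sample_path in auto)

lemma interior_in_I: "l < ereal v \<Longrightarrow> v \<in> I"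
  using interior_subset by auto

lemma space_P: "x \<in> I \<Longrightarrow> space (P x) = space M"
  using sets_P sets_eq_imp_space_eq by blast

lemma measurable_P: "x \<in> I \<Longrightarrow> measurable (P x) N = measurable M N"
  using sets_P by (intro measurable_cong_sets) auto

lemma measurable_shift:
  "(\<lambda>\<omega>. path_from X (enn2real (hit X v \<omega>)) \<omega>) \<in> M \<rightarrow>\<^sub>M explosive_paths"
  by (rule measurable_path_from) auto

lemma measurable_sample_path: "path_from X 0 \<in> M \<rightarrow>\<^sub>M explosive_paths"
  using measurable_path_from[of "\<lambda>_. 0"] by simp

lemma measurable_nice_paths_path_space: "f \<in> N \<rightarrow>\<^sub>M explosive_paths \<Longrightarrow> f \<in> N \<rightarrow>\<^sub>M path_space"
  unfolding explosive_paths_def by (auto simp: measurable_restrict_space2_iff)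

text \<open>
  At a hitting time of \<open>v\<close> the process is alive and at \<open>v\<close>, so the kernel in the strong Markov property is
  constant and the future is independent of the past. Events of \<open>explosive_paths\<close> are traces of events
  of \<open>path_space\<close>, and the trace is invisible because every sample path is continuous.
\<close>

lemma strong_markov_hit_emeasure:
  assumes x: "x \<in> I" and v: "l < ereal v"
    and A: "A \<in> markov_past M X (hit X v)" and B: "B \<in> sets explosive_paths"
  shows "emeasure (P x) {\<omega>\<in>A. hit X v \<omega> < \<infinity> \<and> path_from X (enn2real (hit X v \<omega>)) \<omega> \<in> B} =
    emeasure (P x) {\<omega>\<in>A. hit X v \<omega> < \<infinity>} * emeasure (P v) {\<omega>\<in>space M. path_from X 0 \<omega> \<in> B}"
proof -
  have vI: "v \<in> I" using v by (rule interior_in_I)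
  have As: "A \<in> sets M" "A \<subseteq> space M" using A markov_past_sets sets.sets_into_space by blast+
  obtain B' where B': "B' \<in> sets path_space" "B = {w. explosive_path coord w} \<inter> B'"
    using B unfolding explosive_paths_def by (auto simp: sets_restrict_space)
  have alive: "alive_at X (hit X v) \<omega> \<longleftrightarrow> hit X v \<omega> < \<infinity>" if "\<omega> \<in> A" for \<omega>
    using hit_attained[OF explosive, of \<omega> v] that As by (auto simp: alive_at_def)
  have mem: "path_from X s \<omega> \<in> B \<longleftrightarrow> path_from X s \<omega> \<in> B'" if "\<omega> \<in> space M" "0 \<le> s" for \<omega> s
    using explosive_path_shift[OF explosive, of \<omega> s] that B' by auto
  have "emeasure (P x) {\<omega>\<in>A. hit X v \<omega> < \<infinity> \<and> path_from X (enn2real (hit X v \<omega>)) \<omega> \<in> B} =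
      emeasure (P x) {\<omega>\<in>A. alive_at X (hit X v) \<omega> \<and> path_from X (enn2real (hit X v \<omega>)) \<omega> \<in> B'}"
    using alive mem As by (intro arg_cong[where f = "emeasure (P x)"]) auto
  also have "\<dots> = (\<integral>\<^sup>+ \<omega>\<in>{\<omega>\<in>A. alive_at X (hit X v) \<omega>}.
      emeasure (path_law P X (real_of_ereal (X (enn2real (hit X v \<omega>)) \<omega>))) B' \<partial>P x)"
    by (rule strong_markov[OF x markov_time_hit A B'(1)])
  also have "\<dots> = (\<integral>\<^sup>+ \<omega>. emeasure (path_law P X v) B' * indicator {\<omega>\<in>A. hit X v \<omega> < \<infinity>} \<omega> \<partial>P x)"
  proof (rule nn_integral_cong)
    fix \<omega>
    show "emeasure (path_law P X (real_of_ereal (X (enn2real (hit X v \<omega>)) \<omega>))) B' * indicator {\<omega>\<in>A. alive_at X (hit X v) \<omega>} \<omega>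
        = emeasure (path_law P X v) B' * indicator {\<omega>\<in>A. hit X v \<omega> < \<infinity>} \<omega>"
      using alive[of \<omega>] hit_attained[OF explosive, of \<omega> v] As by (auto simp: indicator_def)
  qed
  also have "\<dots> = emeasure (path_law P X v) B' * emeasure (P x) {\<omega>\<in>A. hit X v \<omega> < \<infinity>}"
  proof (rule nn_integral_cmult_indicator)
    have "{\<omega>\<in>A. hit X v \<omega> < \<infinity>} = A \<inter> {\<omega>\<in>space M. hit X v \<omega> < \<infinity>}" using As by auto
    then show "{\<omega>\<in>A. hit X v \<omega> < \<infinity>} \<in> sets (P x)" using As by (simp add: sets_P[OF x])
  qed
  also have "emeasure (path_law P X v) B' = emeasure (P v) {\<omega>\<in>space M. path_from X 0 \<omega> \<in> B}"
    unfolding path_law_def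
    by (subst emeasure_distr)
      (use measurable_nice_paths_path_space[OF measurable_sample_path] mem B'(1) in
        \<open>auto simp: measurable_P[OF vI] space_P[OF vI] intro!: arg_cong[where f = "emeasure (P v)"]\<close>)
  finally show ?thesis by (simp add: mult.commute)
qed

text \<open>
  The product formula extends from events to functions in two steps: to functions \<open>f\<close> of the future by
  equality of image measures, and to functions \<open>g\<close> of the past by equality of two densities
  restricted to the sigma-algebra of the past.
\<close>

lemma strong_markov_hit_nn_integral:
  assumes x: "x \<in> I" and v: "l < ereal v"
    and g [measurable]: "g \<in> borel_measurable (markov_algebra (hit X v))"
    and f [measurable]: "f \<in> borel_measurable explosive_paths"
  shows "(\<integral>\<^sup>+ \<omega>. g \<omega> * indicator {\<omega>\<in>space M. hit X v \<omega> < \<infinity>} \<omega> * f (path_from X (enn2real (hit X v \<omega>)) \<omega>) \<partial>P x) =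
    (\<integral>\<^sup>+ \<omega>. g \<omega> * indicator {\<omega>\<in>space M. hit X v \<omega> < \<infinity>} \<omega> \<partial>P x) * (\<integral>\<^sup>+ \<omega>. f (path_from X 0 \<omega>) \<partial>P v)"
proof -
  let ?T = "hit X v" let ?F = "markov_algebra (hit X v)"
  let ?H = "{\<omega>\<in>space M. ?T \<omega> < \<infinity>}"
  let ?\<theta> = "\<lambda>\<omega>. path_from X (enn2real (?T \<omega>)) \<omega>"
  let ?c = "\<integral>\<^sup>+ \<omega>. f (path_from X 0 \<omega>) \<partial>P v"
  have vI: "v \<in> I" using v by (rule interior_in_I)
  note [measurable_cong] = sets_P[OF x] sets_P[OF vI]
  have [measurable]: "?\<theta> \<in> M \<rightarrow>\<^sub>M explosive_paths" "path_from X 0 \<in> M \<rightarrow>\<^sub>M explosive_paths"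
    by (rule measurable_shift measurable_sample_path)+
  have H [measurable]: "?H \<in> sets M" by measurable
  have sub: "subalgebra M ?F" by (rule subalgebra_markov_algebra[OF markov_time_hit])
  have gM [measurable]: "g \<in> borel_measurable M" by (rule measurable_from_subalg[OF sub g])
  have indep: "(\<integral>\<^sup>+ \<omega>. indicator (A \<inter> ?H) \<omega> * f (?\<theta> \<omega>) \<partial>P x) = emeasure (P x) (A \<inter> ?H) * ?c"
    if A: "A \<in> markov_past M X ?T" for A
  proof -
    have As [measurable]: "A \<in> sets M" using A markov_past_sets by blast
    have AH: "A \<inter> ?H = {\<omega>\<in>A. ?T \<omega> < \<infinity>}" using sets.sets_into_space[OF As] by auto
    let ?N1 = "distr (density (P x) (indicator (A \<inter> ?H))) explosive_paths ?\<theta>"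
    let ?N2 = "scale_measure (emeasure (P x) (A \<inter> ?H)) (distr (P v) explosive_paths (path_from X 0))"
    have "?N1 = ?N2"
    proof (rule measure_eqI)
      fix B assume "B \<in> sets ?N1"
      then have B [measurable]: "B \<in> sets explosive_paths" by simp
      have "emeasure ?N1 B = (\<integral>\<^sup>+ \<omega>. indicator (A \<inter> ?H) \<omega> * indicator (?\<theta> -` B \<inter> space M) \<omega> \<partial>P x)"
        by (subst emeasure_distr, measurable, subst emeasure_density) (auto simp: space_P[OF x])
      also have "\<dots> = (\<integral>\<^sup>+ \<omega>. indicator {\<omega>\<in>A. ?T \<omega> < \<infinity> \<and> ?\<theta> \<omega> \<in> B} \<omega> \<partial>P x)"
        by (intro nn_integral_cong) (auto simp: indicator_def space_P[OF x])
      also have "\<dots> = emeasure (P x) {\<omega>\<in>A. ?T \<omega> < \<infinity> \<and> ?\<theta> \<omega> \<in> B}"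
      proof (rule nn_integral_indicator)
        have "{\<omega>\<in>A. ?T \<omega> < \<infinity> \<and> ?\<theta> \<omega> \<in> B} = A \<inter> {\<omega>\<in>space M. ?T \<omega> < \<infinity> \<and> ?\<theta> \<omega> \<in> B}"
          using sets.sets_into_space[OF As] by auto
        also have "\<dots> \<in> sets M" by measurable
        finally show "{\<omega>\<in>A. ?T \<omega> < \<infinity> \<and> ?\<theta> \<omega> \<in> B} \<in> sets (P x)" by (simp add: sets_P[OF x])
      qed
      also have "\<dots> = emeasure (P x) (A \<inter> ?H) * emeasure (P v) {\<omega>\<in>space M. path_from X 0 \<omega> \<in> B}"
        unfolding AH by (rule strong_markov_hit_emeasure[OF x v A B])
      also have "emeasure (P v) {\<omega>\<in>space M. path_from X 0 \<omega> \<in> B} = emeasure (distr (P v) explosive_paths (path_from X 0)) B"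
        by (subst emeasure_distr) (auto simp: space_P[OF vI] intro!: arg_cong[where f = "emeasure (P v)"])
      finally show "emeasure ?N1 B = emeasure ?N2 B" by simp
    qed simp
    then have "(\<integral>\<^sup>+ w. f w \<partial>?N1) = (\<integral>\<^sup>+ w. f w \<partial>?N2)" by simp
    then show ?thesis
      by (simp add: nn_integral_distr nn_integral_density nn_integral_scale_measure)
  qed
  \<comment> \<open>Two measures on \<open>M\<close> that agree on the past of the hitting time, by \<open>indep\<close>.\<close>
  let ?M1 = "density (P x) (\<lambda>\<omega>. indicator ?H \<omega> * f (?\<theta> \<omega>))"
  let ?M2 = "density (P x) (\<lambda>\<omega>. indicator ?H \<omega> * ?c)"
  have sub1: "subalgebra ?M1 ?F" and sub2: "subalgebra ?M2 ?F"
    using sub by (auto simp: subalgebra_def space_P[OF x] sets_P[OF x])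
  have "restr_to_subalg ?M1 ?F = restr_to_subalg ?M2 ?F"
  proof (rule measure_eqI)
    fix A assume "A \<in> sets (restr_to_subalg ?M1 ?F)"
    then have AF: "A \<in> sets ?F" using sets_restr_to_subalg[OF sub1] by simp
    then have A: "A \<in> markov_past M X ?T" using sets_markov_algebra[OF markov_time_hit] by simp
    have As [measurable]: "A \<in> sets M" using A markov_past_sets by blast
    have "emeasure ?M1 A = (\<integral>\<^sup>+ \<omega>. indicator (A \<inter> ?H) \<omega> * f (?\<theta> \<omega>) \<partial>P x)"
      by (subst emeasure_density) (auto simp: indicator_inter_arith ac_simps sets_P[OF x])
    also have "\<dots> = emeasure (P x) (A \<inter> ?H) * ?c" by (rule indep[OF A])
    also have "\<dots> = (\<integral>\<^sup>+ \<omega>. ?c * indicator (A \<inter> ?H) \<omega> \<partial>P x)"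
      by (subst nn_integral_cmult_indicator) (auto simp: mult.commute sets_P[OF x])
    also have "\<dots> = emeasure ?M2 A"
      by (subst emeasure_density) (auto simp: indicator_inter_arith ac_simps sets_P[OF x])
    finally show "emeasure (restr_to_subalg ?M1 ?F) A = emeasure (restr_to_subalg ?M2 ?F) A"
      unfolding emeasure_restr_to_subalg[OF sub1 AF] emeasure_restr_to_subalg[OF sub2 AF] .
  qed (unfold sets_restr_to_subalg[OF sub1] sets_restr_to_subalg[OF sub2], rule refl)
  then have "(\<integral>\<^sup>+ \<omega>. g \<omega> \<partial>?M1) = (\<integral>\<^sup>+ \<omega>. g \<omega> \<partial>?M2)"
    using nn_integral_subalgebra2[OF sub1 g] nn_integral_subalgebra2[OF sub2 g] by simp
  then have "(\<integral>\<^sup>+ \<omega>. indicator ?H \<omega> * f (?\<theta> \<omega>) * g \<omega> \<partial>P x) = (\<integral>\<^sup>+ \<omega>. indicator ?H \<omega> * ?c * g \<omega> \<partial>P x)"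
    by (subst (asm) (1 2) nn_integral_density) auto
  also have "\<dots> = (\<integral>\<^sup>+ \<omega>. (g \<omega> * indicator ?H \<omega>) * ?c \<partial>P x)" by (simp add: ac_simps)
  also have "\<dots> = (\<integral>\<^sup>+ \<omega>. g \<omega> * indicator ?H \<omega> \<partial>P x) * ?c" by (rule nn_integral_multc) auto
  finally show ?thesis by (simp add: ac_simps)
qed

lemma measurable_discount [measurable]: "discount \<alpha> \<in> borel_measurable borel"
  unfolding discount_def by measurable

text \<open>
  The form in which the strong Markov property is applied below. The indicator of \<open>hit X v < \<infinity>\<close> is
  absorbed by the discount factor, which vanishes off this event.
\<close>

lemma strong_markov_discount:
  assumes x: "x \<in> I" and v: "l < ereal v" and \<alpha>: "0 < \<alpha>"
    and A: "A \<in> markov_past M X (hit X v)"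
    and f [measurable]: "f \<in> borel_measurable explosive_paths" and f01: "\<And>w. 0 \<le> f w" "\<And>w. f w \<le> (1::real)"
  shows "(\<integral>\<omega>. discount \<alpha> (hit X v \<omega>) * indicator A \<omega> * f (path_from X (enn2real (hit X v \<omega>)) \<omega>) \<partial>P x) =
    (\<integral>\<omega>. discount \<alpha> (hit X v \<omega>) * indicator A \<omega> \<partial>P x) * (\<integral>\<omega>. f (path_from X 0 \<omega>) \<partial>P v)"
proof -
  let ?T = "hit X v" let ?F = "markov_algebra (hit X v)"
  let ?H = "{\<omega>\<in>space M. ?T \<omega> < \<infinity>}"
  let ?\<theta> = "\<lambda>\<omega>. path_from X (enn2real (?T \<omega>)) \<omega>"
  have vI: "v \<in> I" using v by (rule interior_in_I)
  note [measurable_cong] = sets_P[OF x] sets_P[OF vI]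
  have [measurable]: "?\<theta> \<in> M \<rightarrow>\<^sub>M explosive_paths" "path_from X 0 \<in> M \<rightarrow>\<^sub>M explosive_paths"
    by (rule measurable_shift measurable_sample_path)+
  have As [measurable]: "A \<in> sets M" using A markov_past_sets by blast
  have AF [measurable]: "A \<in> sets ?F" using A sets_markov_algebra[OF markov_time_hit] by simp
  have [measurable]: "?T \<in> borel_measurable ?F" by (rule measurable_markov_time[OF markov_time_hit])
  define g where "g \<omega> = ennreal (discount \<alpha> (?T \<omega>) * indicator A \<omega>)" for \<omega>
  have g [measurable]: "g \<in> borel_measurable ?F" unfolding g_def by measurable
  have gH: "g \<omega> * indicator ?H \<omega> = g \<omega>" if "\<omega> \<in> space M" for \<omega>
    using that by (cases "?T \<omega> = \<infinity>") (auto simp: g_def discount_def indicator_def less_top)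
  have "(\<integral>\<omega>. discount \<alpha> (?T \<omega>) * indicator A \<omega> * f (?\<theta> \<omega>) \<partial>P x) =
      enn2real (\<integral>\<^sup>+ \<omega>. ennreal (discount \<alpha> (?T \<omega>) * indicator A \<omega> * f (?\<theta> \<omega>)) \<partial>P x)"
    by (rule integral_eq_nn_integral) (auto simp: discount_nonneg f01)
  also have "(\<integral>\<^sup>+ \<omega>. ennreal (discount \<alpha> (?T \<omega>) * indicator A \<omega> * f (?\<theta> \<omega>)) \<partial>P x) =
      (\<integral>\<^sup>+ \<omega>. g \<omega> * indicator ?H \<omega> * ennreal (f (?\<theta> \<omega>)) \<partial>P x)"
    using gH by (intro nn_integral_cong) (auto simp: g_def space_P[OF x] ennreal_mult discount_nonneg f01)
  also have "\<dots> = (\<integral>\<^sup>+ \<omega>. g \<omega> * indicator ?H \<omega> \<partial>P x) * (\<integral>\<^sup>+ \<omega>. ennreal (f (path_from X 0 \<omega>)) \<partial>P v)"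
    using strong_markov_hit_nn_integral[OF x v g, of "\<lambda>w. ennreal (f w)"] by simp
  also have "(\<integral>\<^sup>+ \<omega>. g \<omega> * indicator ?H \<omega> \<partial>P x) = (\<integral>\<^sup>+ \<omega>. g \<omega> \<partial>P x)"
    using gH by (intro nn_integral_cong) (auto simp: space_P[OF x])
  finally have "(\<integral>\<omega>. discount \<alpha> (?T \<omega>) * indicator A \<omega> * f (?\<theta> \<omega>) \<partial>P x) =
      enn2real (\<integral>\<^sup>+ \<omega>. g \<omega> \<partial>P x) * enn2real (\<integral>\<^sup>+ \<omega>. ennreal (f (path_from X 0 \<omega>)) \<partial>P v)"
    by (simp add: enn2real_mult)
  also have "enn2real (\<integral>\<^sup>+ \<omega>. g \<omega> \<partial>P x) = (\<integral>\<omega>. discount \<alpha> (?T \<omega>) * indicator A \<omega> \<partial>P x)"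
    unfolding g_def by (rule integral_eq_nn_integral[symmetric]) (auto simp: discount_nonneg)
  also have "enn2real (\<integral>\<^sup>+ \<omega>. ennreal (f (path_from X 0 \<omega>)) \<partial>P v) = (\<integral>\<omega>. f (path_from X 0 \<omega>) \<partial>P v)"
    by (rule integral_eq_nn_integral[symmetric]) (auto simp: f01)
  finally show ?thesis .
qed

end


section \<open>Transforms of hitting and exit times\<close>

context regular_diffusion
begin

definition hit_transform :: "real \<Rightarrow> real \<Rightarrow> real \<Rightarrow> real" where
  "hit_transform \<alpha> u v = (\<integral>\<omega>. discount \<alpha> (hit X v \<omega>) \<partial>P u)"

definition exit_transform :: "real \<Rightarrow> real \<Rightarrow> real \<Rightarrow> real \<Rightarrow> real" where
  "exit_transform \<alpha> c u v =
     (\<integral>\<omega>. discount \<alpha> (hit X v \<omega>) * indicator {\<omega>\<in>space M. hit X v \<omega> < hit X c \<omega>} \<omega> \<partial>P u)"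

definition no_drop_transform :: "real \<Rightarrow> real \<Rightarrow> real \<Rightarrow> real \<Rightarrow> real" where
  "no_drop_transform \<alpha> y u v =
     (\<integral>\<omega>. discount \<alpha> (hit X v \<omega>) * indicator (no_drop_event y v) \<omega> \<partial>P u)"

lemma integrable_discount_indicator:
  assumes "u \<in> I" "0 < \<alpha>" and [measurable]: "A \<in> sets M"
  shows "integrable (P u) (\<lambda>\<omega>. discount \<alpha> (hit X v \<omega>) * indicator A \<omega>)"
proof -
  interpret prob_space "P u" by (rule prob_space_P[OF assms(1)])
  note [measurable_cong] = sets_P[OF assms(1)]
  show ?thesis
    by (rule integrable_const_bound[of _ 1])
      (use discount_nonneg[of \<alpha>] discount_le_1[OF assms(2)] in \<open>auto simp: indicator_def\<close>)
qed

lemma integrable_discount: "u \<in> I \<Longrightarrow> 0 < \<alpha> \<Longrightarrow> integrable (P u) (\<lambda>\<omega>. discount \<alpha> (hit X v \<omega>))"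
  using integrable_discount_indicator[of u \<alpha> "space M" v] space_P[of u]
  by (subst Bochner_Integration.integrable_cong[OF refl, of _ _ "\<lambda>\<omega>. discount \<alpha> (hit X v \<omega>) * indicator (space M) \<omega>"]) auto

lemma discount_hit_shift:
  assumes \<omega>: "\<omega> \<in> space M" and le: "hit X c \<omega> \<le> hit X v \<omega>"
  shows "discount \<alpha> (hit X v \<omega>) =
    discount \<alpha> (hit X c \<omega>) * discount \<alpha> (hit coord v (path_from X (enn2real (hit X c \<omega>)) \<omega>))"
proof (cases "hit X c \<omega>")
  case (real T)
  then show ?thesis
    using hit_shift[OF explosive[OF \<omega>], of T v] le discount_add[of T \<alpha>] discount_add[of T \<alpha> 0]
    by (simp add: discount_def)
next
  case top
  then show ?thesis using le by (simp add: discount_def top_unique)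
qed

text \<open>
  To reach \<open>v\<close> the path either avoids \<open>c\<close>, or it hits \<open>c\<close> first and starts afresh there. The two
  hitting times cannot coincide unless both are infinite.
\<close>

lemma hit_transform_split:
  assumes u: "u \<in> I" and c: "l < ereal c" and ne: "c \<noteq> v" and \<alpha>: "0 < \<alpha>"
  shows "hit_transform \<alpha> u v = exit_transform \<alpha> c u v + exit_transform \<alpha> v u c * hit_transform \<alpha> c v"
proof -
  let ?A = "{\<omega>\<in>space M. hit X c \<omega> < hit X v \<omega>}" and ?B = "{\<omega>\<in>space M. hit X v \<omega> < hit X c \<omega>}"
  let ?f = "\<lambda>w. discount \<alpha> (hit coord v w)"
  let ?\<theta> = "\<lambda>\<omega>. path_from X (enn2real (hit X c \<omega>)) \<omega>"
  note [measurable_cong] = sets_P[OF u]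
  have [measurable]: "?A \<in> sets M" "?B \<in> sets M" by measurable
  have [measurable]: "?\<theta> \<in> M \<rightarrow>\<^sub>M explosive_paths" by (rule measurable_shift)
  interpret prob_space "P u" by (rule prob_space_P[OF u])
  have split: "discount \<alpha> (hit X v \<omega>) = discount \<alpha> (hit X v \<omega>) * indicator ?B \<omega> +
      discount \<alpha> (hit X c \<omega>) * indicator ?A \<omega> * ?f (?\<theta> \<omega>)" if \<omega>: "\<omega> \<in> space M" for \<omega>
  proof -
    consider "hit X c \<omega> < hit X v \<omega>" | "hit X v \<omega> < hit X c \<omega>" | "hit X v \<omega> = hit X c \<omega>"
      by (metis linorder_less_linear)
    then show ?thesis
    proof cases
      case 1 then show ?thesis
        using \<omega> discount_hit_shift[OF \<omega>, of c v] by auto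
    next
      case 3
      have "hit X v \<omega> = \<infinity>"
      proof (rule ccontr)
        assume "hit X v \<omega> \<noteq> \<infinity>"
        then have fin: "hit X v \<omega> < \<infinity>" by (simp add: less_top)
        have "X (enn2real (hit X c \<omega>)) \<omega> = ereal c"
          by (rule hit_attained[OF explosive[OF \<omega>] fin[unfolded 3]])
        moreover have "X (enn2real (hit X c \<omega>)) \<omega> = ereal v"
          using hit_attained[OF explosive[OF \<omega>] fin] unfolding 3 .
        ultimately show False using ne by simp
      qed
      then have "discount \<alpha> (hit X v \<omega>) = 0" "discount \<alpha> (hit X c \<omega>) = 0"
        unfolding 3[symmetric] by (simp_all add: discount_def)
      then show ?thesis by simp
    qed (use \<omega> in auto)
  qed
  have int: "integrable (P u) (\<lambda>\<omega>. discount \<alpha> (hit X c \<omega>) * indicator ?A \<omega> * ?f (?\<theta> \<omega>))"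
    by (rule integrable_const_bound[of _ 1])
      (use discount_nonneg[of \<alpha>] discount_le_1[OF \<alpha>] in \<open>auto simp: indicator_def abs_mult intro!: mult_le_one\<close>)
  have "hit_transform \<alpha> u v = (\<integral>\<omega>. discount \<alpha> (hit X v \<omega>) * indicator ?B \<omega> +
      discount \<alpha> (hit X c \<omega>) * indicator ?A \<omega> * ?f (?\<theta> \<omega>) \<partial>P u)"
    unfolding hit_transform_def using split by (intro Bochner_Integration.integral_cong) (auto simp: space_P[OF u])
  also have "\<dots> = exit_transform \<alpha> c u v + (\<integral>\<omega>. discount \<alpha> (hit X c \<omega>) * indicator ?A \<omega> * ?f (?\<theta> \<omega>) \<partial>P u)"
    unfolding exit_transform_def
    by (rule Bochner_Integration.integral_add[OF integrable_discount_indicator[OF u \<alpha>] int]) measurable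
  also have "(\<integral>\<omega>. discount \<alpha> (hit X c \<omega>) * indicator ?A \<omega> * ?f (?\<theta> \<omega>) \<partial>P u) =
      exit_transform \<alpha> v u c * (\<integral>\<omega>. ?f (path_from X 0 \<omega>) \<partial>P c)"
    unfolding exit_transform_def
    by (rule strong_markov_discount[OF u c \<alpha> hit_first_markov_past])
      (use discount_nonneg discount_le_1[OF \<alpha>] in auto)
  also have "(\<integral>\<omega>. ?f (path_from X 0 \<omega>) \<partial>P c) = hit_transform \<alpha> c v"
    by (simp add: hit_transform_def hit_path_from_0)
  finally show ?thesis .
qed

text \<open>
  A continuous path needs a positive time to move to a different level.
\<close>

lemma hit_transform_less_1:
  assumes u: "u \<in> I" and ne: "u \<noteq> v" and \<alpha>: "0 < \<alpha>"
  shows "hit_transform \<alpha> u v < 1"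
proof -
  interpret prob_space "P u" by (rule prob_space_P[OF u])
  have "AE \<omega> in P u. discount \<alpha> (hit X v \<omega>) < 1"
    using start[OF u] AE_space
  proof eventually_elim
    fix \<omega> assume X0: "X 0 \<omega> = ereal u" and "\<omega> \<in> space (P u)"
    then have \<omega>: "\<omega> \<in> space M" by (simp add: space_P[OF u])
    show "discount \<alpha> (hit X v \<omega>) < 1"
    proof (cases "hit X v \<omega>")
      case (real h)
      then have "h \<noteq> 0" using hit_attained[OF explosive[OF \<omega>], of v] X0 ne by auto
      then show ?thesis using real \<alpha> by (simp add: discount_def)
    qed (simp add: discount_def)
  qed
  then have "(\<integral>\<omega>. discount \<alpha> (hit X v \<omega>) \<partial>P u) < (\<integral>\<omega>. 1 \<partial>P u)"
    by (intro integral_less_AE_space integrable_discount[OF u \<alpha>]) (auto simp: emeasure_space_1)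
  then show ?thesis by (simp add: hit_transform_def prob_space)
qed

lemma no_drop_event_path_from:
  assumes \<omega>: "\<omega> \<in> space M" and s: "0 \<le> s"
  shows "path_from X s \<omega> \<in> paths.no_drop_event y w \<longleftrightarrow>
    hit coord w (path_from X s \<omega>) < \<infinity> \<and> no_drop coord y (enn2real (hit coord w (path_from X s \<omega>))) (path_from X s \<omega>)"
proof -
  have "path_from X s \<omega> \<in> space explosive_paths"
    using measurable_space[OF measurable_path_from[of "\<lambda>_. s"] \<omega>] s by simp
  then show ?thesis by (simp add: paths.no_drop_event_def)
qed

lemma no_drop_path_from_0: "no_drop coord y h (path_from X 0 \<omega>) \<longleftrightarrow> no_drop X y h \<omega>"
  unfolding no_drop_def path_from_def by auto

lemma hit_mono:
  assumes \<omega>: "\<omega> \<in> space M" and "X 0 \<omega> \<le> ereal v" "v \<le> w"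
  shows "hit X v \<omega> \<le> hit X w \<omega>"
proof (rule ccontr)
  assume "\<not> hit X v \<omega> \<le> hit X w \<omega>"
  then have less: "hit X w \<omega> < hit X v \<omega>" by simp
  then have fin: "hit X w \<omega> < \<infinity>" by (auto simp: less_top[symmetric])
  have "ereal w \<le> ereal v"
    using path_le_level[OF explosive[OF \<omega>] assms(2), of "enn2real (hit X w \<omega>)"] less fin
      hit_attained[OF explosive[OF \<omega>] fin] by simp
  then have "v = w" using assms(3) by simp
  then show False using less by simp
qed

text \<open>
  The central identity: \<open>no_drop_concat\<close> factorises the event at the hitting time of the intermediate
  level \<open>v\<close>, and the strong Markov property makes the factors independent.
\<close>

lemma no_drop_transform_mult:
  assumes u: "u \<in> I" and v: "l < ereal v" and uv: "u \<le> v" "v \<le> w" and \<alpha>: "0 < \<alpha>" and y: "0 < y"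
  shows "no_drop_transform \<alpha> y u w = no_drop_transform \<alpha> y u v * no_drop_transform \<alpha> y v w"
proof -
  let ?f = "\<lambda>p. discount \<alpha> (hit coord w p) * indicator (paths.no_drop_event y w) p :: real"
  let ?\<theta> = "\<lambda>\<omega>. path_from X (enn2real (hit X v \<omega>)) \<omega>"
  note [measurable_cong] = sets_P[OF u]
  have [measurable]: "no_drop_event y v \<in> sets M" "no_drop_event y w \<in> sets M"
    using y by (auto intro: no_drop_event_sets)
  have [measurable]: "paths.no_drop_event y w \<in> sets explosive_paths"
    using y by (rule paths.no_drop_event_sets)
  have [measurable]: "?\<theta> \<in> M \<rightarrow>\<^sub>M explosive_paths" by (rule measurable_shift)
  have vI: "v \<in> I" using v by (rule interior_in_I)
  have split: "discount \<alpha> (hit X w \<omega>) * indicator (no_drop_event y w) \<omega> =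
      discount \<alpha> (hit X v \<omega>) * indicator (no_drop_event y v) \<omega> * ?f (?\<theta> \<omega>)"
    if \<omega>: "\<omega> \<in> space M" and X0: "X 0 \<omega> = ereal u" for \<omega>
  proof -
    note p = explosive[OF \<omega>]
    have X0v: "X 0 \<omega> \<le> ereal v" using X0 uv by simp
    have le: "hit X v \<omega> \<le> hit X w \<omega>" by (rule hit_mono[OF \<omega> X0v uv(2)])
    note d = discount_hit_shift[OF \<omega> le, of \<alpha>]
    show ?thesis
    proof (cases "hit X w \<omega> = \<infinity>")
      case True
      then show ?thesis using d by (auto simp: discount_def split: if_splits)
    next
      case False
      then have fin: "hit X w \<omega> < \<infinity>" by (simp add: less_top)
      then have "hit X v \<omega> < \<infinity>" using le by (rule le_less_trans[rotated])
      then obtain T where T: "0 \<le> T" "hit X v \<omega> = ennreal T" by (cases "hit X v \<omega>") auto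
      let ?h = "hit coord w (path_from X T \<omega>)"
      have sh: "hit X w \<omega> = ennreal T + ?h" using hit_shift[OF p T(1)] le T(2) by simp
      then obtain h where h: "0 \<le> h" "?h = ennreal h" using fin by (cases ?h) auto
      have hw: "enn2real (hit X w \<omega>) = T + h" using sh h T by (simp flip: ennreal_plus)
      have "\<omega> \<in> no_drop_event y w \<longleftrightarrow> no_drop X y (T + h) \<omega>"
        using \<omega> fin hw by (simp add: no_drop_event_def)
      also have "\<dots> \<longleftrightarrow> no_drop X y T \<omega> \<and> no_drop coord y h (path_from X T \<omega>)"
        by (rule no_drop_concat[OF p X0v T h(1)])
      also have "\<dots> \<longleftrightarrow> \<omega> \<in> no_drop_event y v \<and> path_from X T \<omega> \<in> paths.no_drop_event y w"
        unfolding no_drop_event_path_from[OF \<omega> T(1)] using \<omega> T h by (simp add: no_drop_event_def)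
      finally show ?thesis using d T by (simp add: indicator_def)
    qed
  qed
  have "no_drop_transform \<alpha> y u w =
      (\<integral>\<omega>. discount \<alpha> (hit X v \<omega>) * indicator (no_drop_event y v) \<omega> * ?f (?\<theta> \<omega>) \<partial>P u)"
    unfolding no_drop_transform_def
  proof (rule integral_cong_AE)
    show "AE \<omega> in P u. discount \<alpha> (hit X w \<omega>) * indicator (no_drop_event y w) \<omega> =
      discount \<alpha> (hit X v \<omega>) * indicator (no_drop_event y v) \<omega> * ?f (?\<theta> \<omega>)"
      using start[OF u] AE_space by eventually_elim (use split space_P[OF u] in auto)
  qed measurable
  also have "\<dots> = no_drop_transform \<alpha> y u v * (\<integral>\<omega>. ?f (path_from X 0 \<omega>) \<partial>P v)"
    unfolding no_drop_transform_def
    by (rule strong_markov_discount[OF u v \<alpha> no_drop_event_markov_past[OF y]])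
      (use discount_nonneg[of \<alpha>] discount_le_1[OF \<alpha>] in \<open>auto simp: indicator_def\<close>)
  also have "(\<integral>\<omega>. ?f (path_from X 0 \<omega>) \<partial>P v) = no_drop_transform \<alpha> y v w"
    unfolding no_drop_transform_def
  proof (rule Bochner_Integration.integral_cong[OF refl])
    fix \<omega> assume "\<omega> \<in> space (P v)"
    then have \<omega>: "\<omega> \<in> space M" by (simp add: space_P[OF vI])
    show "?f (path_from X 0 \<omega>) = discount \<alpha> (hit X w \<omega>) * indicator (no_drop_event y w) \<omega>"
      using no_drop_event_path_from[OF \<omega>, of 0 y w] \<omega>
      by (simp add: indicator_def hit_path_from_0 no_drop_path_from_0 no_drop_event_def)
  qed
  finally show ?thesis .
qed

text \<open>
  While the maximum is at most \<open>y + l\<close> a fall of size \<open>y\<close> would have to lead below \<open>l\<close>; equality is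
  possible only for a fall from \<open>a\<close> itself, which is reached at the last moment.
\<close>

lemma no_drop_transform_near_boundary:
  assumes u: "u \<in> I" and ua: "u \<le> a" and a: "ereal a \<le> ereal y + l" and \<alpha>: "0 < \<alpha>" and y: "0 < y"
  shows "no_drop_transform \<alpha> y u a = hit_transform \<alpha> u a"
  unfolding no_drop_transform_def hit_transform_def
proof (rule integral_cong_AE)
  note [measurable_cong] = sets_P[OF u]
  have [measurable]: "no_drop_event y a \<in> sets M" using y by (rule no_drop_event_sets)
  show "(\<lambda>\<omega>. discount \<alpha> (hit X a \<omega>) * indicator (no_drop_event y a) \<omega>) \<in> borel_measurable (P u)"
    "(\<lambda>\<omega>. discount \<alpha> (hit X a \<omega>)) \<in> borel_measurable (P u)" by measurable
  show "AE \<omega> in P u. discount \<alpha> (hit X a \<omega>) * indicator (no_drop_event y a) \<omega> = discount \<alpha> (hit X a \<omega>)"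
    using start[OF u] AE_space
  proof eventually_elim
    fix \<omega> assume X0: "X 0 \<omega> = ereal u" and "\<omega> \<in> space (P u)"
    then have \<omega>: "\<omega> \<in> space M" by (simp add: space_P[OF u])
    show "discount \<alpha> (hit X a \<omega>) * indicator (no_drop_event y a) \<omega> = discount \<alpha> (hit X a \<omega>)"
    proof (cases "hit X a \<omega> = \<infinity>")
      case False
      then obtain h where h: "hit X a \<omega> = ennreal h" "0 \<le> h" by (cases "hit X a \<omega>") auto
      have Xh: "X h \<omega> = ereal a" using hit_attained[OF explosive[OF \<omega>], of a] h by simp
      have "no_drop X y h \<omega>" unfolding no_drop_def
      proof (intro allI impI)
        fix s t assume st: "0 \<le> s" "s \<le> t" "t \<le> h"
        have ge: "l \<le> X t \<omega>" using state_values[of t \<omega>] subset_closure \<omega> st by auto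
        have le: "X s \<omega> \<le> ereal a"
          using path_le_level[OF explosive[OF \<omega>], of a s] X0 ua st h by (simp add: ennreal_leI)
        have fin: "\<bar>X t \<omega>\<bar> \<noteq> \<infinity>" using path_finite_before[OF explosive[OF \<omega>], of h t] Xh st by simp
        show "X s \<omega> < X t \<omega> + ereal y"
        proof (cases "X s \<omega> = ereal a")
          case True
          then have "ennreal h \<le> ennreal s" using hit_le[of s X \<omega> a] st h by simp
          then have "s = t" using st by simp
          then show ?thesis using True y by simp
        next
          case False
          then have "X s \<omega> < ereal a" using le by simp
          also have "\<dots> \<le> ereal y + l" by (rule a)
          also have "\<dots> \<le> ereal y + X t \<omega>" using ge by (rule add_left_mono)
          also have "\<dots> = X t \<omega> + ereal y" by (rule add.commute)
          finally show ?thesis .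
        qed
      qed
      then show ?thesis using h \<omega> by (simp add: no_drop_event_def)
    qed (simp add: discount_def)
  qed
qed

text \<open>
  On the way from \<open>u\<close> to \<open>v\<close> the maximum is at most \<open>v\<close>, so staying above \<open>v - y\<close> prevents a fall of size \<open>y\<close>.
\<close>

lemma no_drop_transform_ge_exit:
  assumes u: "u \<in> I" and uv: "u \<le> v" "v - y < u" and \<alpha>: "0 < \<alpha>" and y: "0 < y"
  shows "exit_transform \<alpha> (v - y) u v \<le> no_drop_transform \<alpha> y u v"
  unfolding no_drop_transform_def exit_transform_def
proof (rule integral_mono_AE)
  show "integrable (P u) (\<lambda>\<omega>. discount \<alpha> (hit X v \<omega>) * indicator (no_drop_event y v) \<omega>)"
    by (rule integrable_discount_indicator[OF u \<alpha> no_drop_event_sets[OF y]])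
  show "integrable (P u) (\<lambda>\<omega>. discount \<alpha> (hit X v \<omega>) * indicator {\<omega>\<in>space M. hit X v \<omega> < hit X (v - y) \<omega>} \<omega>)"
    by (rule integrable_discount_indicator[OF u \<alpha>]) measurable
  show "AE \<omega> in P u. discount \<alpha> (hit X v \<omega>) * indicator {\<omega>\<in>space M. hit X v \<omega> < hit X (v - y) \<omega>} \<omega>
      \<le> discount \<alpha> (hit X v \<omega>) * indicator (no_drop_event y v) \<omega>"
    using start[OF u] AE_space
  proof eventually_elim
    fix \<omega> assume X0: "X 0 \<omega> = ereal u" and "\<omega> \<in> space (P u)"
    then have \<omega>: "\<omega> \<in> space M" by (simp add: space_P[OF u])
    note p = explosive[OF \<omega>]
    have "\<omega> \<in> no_drop_event y v" if less: "hit X v \<omega> < hit X (v - y) \<omega>"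
    proof -
      have fin: "hit X v \<omega> < \<infinity>" using less by (auto simp: less_top[symmetric])
      then obtain h where h: "hit X v \<omega> = ennreal h" "0 \<le> h" by (cases "hit X v \<omega>") auto
      have "no_drop X y h \<omega>" unfolding no_drop_def
      proof (intro allI impI)
        fix s t assume st: "0 \<le> s" "s \<le> t" "t \<le> h"
        have "ennreal t \<le> ennreal h" using st by (simp add: ennreal_leI)
        also have "\<dots> < hit X (v - y) \<omega>" using less h by simp
        finally have lt: "ennreal t < hit X (v - y) \<omega>" .
        have "ereal (v - y) \<le> X t \<omega>"
          using path_ge_level[OF p, of "v - y" t] X0 uv lt st by simp
        moreover have "X t \<omega> \<noteq> ereal (v - y)" using hit_le[of t X \<omega> "v - y"] lt st by auto
        ultimately have gt: "ereal (v - y) < X t \<omega>" by simp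
        have "X s \<omega> \<le> ereal v" using path_le_level[OF p, of v s] X0 uv st h by (simp add: ennreal_leI)
        also have "ereal v < X t \<omega> + ereal y" using gt by (cases "X t \<omega>") auto
        finally show "X s \<omega> < X t \<omega> + ereal y" .
      qed
      then show ?thesis using \<omega> h by (simp add: no_drop_event_def)
    qed
    then show "discount \<alpha> (hit X v \<omega>) * indicator {\<omega>\<in>space M. hit X v \<omega> < hit X (v - y) \<omega>} \<omega>
      \<le> discount \<alpha> (hit X v \<omega>) * indicator (no_drop_event y v) \<omega>"
      using discount_nonneg[of \<alpha>] by (auto simp: indicator_def)
  qed
qed

text \<open>
  The maximum is at least the starting point \<open>u\<close>, so a visit to \<open>u - y\<close> is a fall of size \<open>y\<close>.
\<close>

lemma no_drop_transform_le_exit: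
  assumes u: "u \<in> I" and \<alpha>: "0 < \<alpha>" and y: "0 < y"
  shows "no_drop_transform \<alpha> y u v \<le> exit_transform \<alpha> (u - y) u v"
  unfolding no_drop_transform_def exit_transform_def
proof (rule integral_mono_AE)
  show "integrable (P u) (\<lambda>\<omega>. discount \<alpha> (hit X v \<omega>) * indicator (no_drop_event y v) \<omega>)"
    by (rule integrable_discount_indicator[OF u \<alpha> no_drop_event_sets[OF y]])
  show "integrable (P u) (\<lambda>\<omega>. discount \<alpha> (hit X v \<omega>) * indicator {\<omega>\<in>space M. hit X v \<omega> < hit X (u - y) \<omega>} \<omega>)"
    by (rule integrable_discount_indicator[OF u \<alpha>]) measurable
  show "AE \<omega> in P u. discount \<alpha> (hit X v \<omega>) * indicator (no_drop_event y v) \<omega>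
      \<le> discount \<alpha> (hit X v \<omega>) * indicator {\<omega>\<in>space M. hit X v \<omega> < hit X (u - y) \<omega>} \<omega>"
    using start[OF u] AE_space
  proof eventually_elim
    fix \<omega> assume X0: "X 0 \<omega> = ereal u" and "\<omega> \<in> space (P u)"
    then have \<omega>: "\<omega> \<in> space M" by (simp add: space_P[OF u])
    note p = explosive[OF \<omega>]
    have "hit X v \<omega> < hit X (u - y) \<omega>" if "\<omega> \<in> no_drop_event y v"
    proof (rule ccontr)
      assume "\<not> hit X v \<omega> < hit X (u - y) \<omega>"
      then have le: "hit X (u - y) \<omega> \<le> hit X v \<omega>" by simp
      have nd: "hit X v \<omega> < \<infinity>" "no_drop X y (enn2real (hit X v \<omega>)) \<omega>"
        using that by (auto simp: no_drop_event_def)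
      have fin: "hit X (u - y) \<omega> < \<infinity>" using le nd(1) by (rule le_less_trans)
      let ?t = "enn2real (hit X (u - y) \<omega>)"
      have "?t \<le> enn2real (hit X v \<omega>)" using le nd(1) by (intro enn2real_mono) auto
      then have "X 0 \<omega> < X ?t \<omega> + ereal y" using nd(2) by (simp add: no_drop_def)
      then show False using X0 hit_attained[OF p fin] by simp
    qed
    then show "discount \<alpha> (hit X v \<omega>) * indicator (no_drop_event y v) \<omega>
      \<le> discount \<alpha> (hit X v \<omega>) * indicator {\<omega>\<in>space M. hit X v \<omega> < hit X (u - y) \<omega>} \<omega>"
      using discount_nonneg[of \<alpha>] \<omega> by (auto simp: indicator_def)
  qed
qed

lemma no_drop_transform_refl:
  assumes u: "u \<in> I" and y: "0 < y"
  shows "no_drop_transform \<alpha> y u u = 1"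
proof -
  interpret prob_space "P u" by (rule prob_space_P[OF u])
  note [measurable_cong] = sets_P[OF u]
  have [measurable]: "no_drop_event y u \<in> sets M" using y by (rule no_drop_event_sets)
  have "no_drop_transform \<alpha> y u u = (\<integral>\<omega>. 1 \<partial>P u)"
    unfolding no_drop_transform_def
  proof (rule integral_cong_AE)
    show "AE \<omega> in P u. discount \<alpha> (hit X u \<omega>) * indicator (no_drop_event y u) \<omega> = (1::real)"
      using start[OF u] AE_space
    proof eventually_elim
      fix \<omega> assume X0: "X 0 \<omega> = ereal u" and "\<omega> \<in> space (P u)"
      then have \<omega>: "\<omega> \<in> space M" by (simp add: space_P[OF u])
      have h: "hit X u \<omega> = 0" using hit_le[of 0 X \<omega> u] X0 by simp
      have "no_drop X y 0 \<omega>" unfolding no_drop_def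
      proof (intro allI impI)
        fix s t :: real assume "0 \<le> s" "s \<le> t" "t \<le> 0"
        then have "s = 0" "t = 0" by auto
        then show "X s \<omega> < X t \<omega> + ereal y" using X0 y by simp
      qed
      then show "discount \<alpha> (hit X u \<omega>) * indicator (no_drop_event y u) \<omega> = 1"
        using \<omega> h by (simp add: no_drop_event_def discount_def)
    qed
  qed measurable
  then show ?thesis by (simp add: prob_space)
qed

lemma no_drop_transform_le_1:
  assumes u: "u \<in> I" and \<alpha>: "0 < \<alpha>" and y: "0 < y"
  shows "no_drop_transform \<alpha> y u v \<le> 1"
proof -
  interpret prob_space "P u" by (rule prob_space_P[OF u])
  have "no_drop_transform \<alpha> y u v \<le> (\<integral>\<omega>. 1 \<partial>P u)"
    unfolding no_drop_transform_def
    by (intro integral_mono integrable_discount_indicator[OF u \<alpha> no_drop_event_sets[OF y]])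
      (use discount_nonneg[of \<alpha>] discount_le_1[OF \<alpha>] in \<open>auto simp: indicator_def\<close>)
  then show ?thesis by (simp add: prob_space)
qed

text \<open>
  Where the hitting time is infinite, \<open>enn2real\<close> returns the time \<open>0\<close>, but the discount factor vanishes there.
\<close>

lemma no_drop_transform_eq_max_decrease:
  assumes "u \<in> I"
  shows "(\<integral>\<omega>. discount \<alpha> (hit X v \<omega>) *
      indicator {\<omega>\<in>space M. max_decrease X (enn2real (hit X v \<omega>)) \<omega> < ereal y} \<omega> \<partial>P u) =
    no_drop_transform \<alpha> y u v"
  unfolding no_drop_transform_def
proof (rule Bochner_Integration.integral_cong[OF refl])
  fix \<omega> assume "\<omega> \<in> space (P u)"
  then have \<omega>: "\<omega> \<in> space M" by (simp add: space_P[OF assms])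
  show "discount \<alpha> (hit X v \<omega>) * indicator {\<omega>\<in>space M. max_decrease X (enn2real (hit X v \<omega>)) \<omega> < ereal y} \<omega> =
      discount \<alpha> (hit X v \<omega>) * indicator (no_drop_event y v) \<omega>"
  proof (cases "hit X v \<omega> = \<infinity>")
    case False
    then have fin: "hit X v \<omega> < \<infinity>" by (simp add: less_top)
    have "X (enn2real (hit X v \<omega>)) \<omega> < \<infinity>" using hit_attained[OF explosive[OF \<omega>] fin] by simp
    then show ?thesis
      using max_decrease_less_iff_no_drop[OF explosive[OF \<omega>], of "enn2real (hit X v \<omega>)" y] fin \<omega>
      by (simp add: no_drop_event_def indicator_def)
  qed (simp add: discount_def)
qed

end


section \<open>Functions determined by their left derivative with respect to the scale\<close>

lemma open_interior: "open {z. l < ereal z}"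
  by (intro open_Collect_less continuous_intros)

lemma left_scale_deriv_eq: "has_left_scale_deriv S u D z \<Longrightarrow> left_scale_deriv S u z = D"
  unfolding left_scale_deriv_def has_left_scale_deriv_def
  by (rule the_equality) (auto intro: tendsto_unique[OF trivial_limit_at_left_real])

lemma has_left_scale_deriv_scale:
  assumes mono: "strict_mono_on {a..b} S" and z: "a < z" "z \<le> b"
  shows "has_left_scale_deriv S S 1 z"
proof -
  have "\<forall>\<^sub>F t in at_left z. (S t - S z) / (S t - S z) = 1"
    using eventually_at_left_real[OF z(1)]
  proof eventually_elim
    case (elim t)
    then have "S t < S z" using mono z by (auto simp: strict_mono_on_def)
    then show ?case by simp
  qed
  then show ?thesis unfolding has_left_scale_deriv_def by (rule tendsto_eventually)
qed

lemma has_left_scale_deriv_linear: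
  assumes "has_left_scale_deriv S f D z" "has_left_scale_deriv S g E z"
  shows "has_left_scale_deriv S (\<lambda>t. f t + c * g t) (D + c * E) z"
proof -
  have "((\<lambda>t. (f t - f z) / (S t - S z) + c * ((g t - g z) / (S t - S z))) \<longlongrightarrow> D + c * E) (at_left z)"
    using assms unfolding has_left_scale_deriv_def by (intro tendsto_intros)
  then show ?thesis unfolding has_left_scale_deriv_def
    by (simp add: add_divide_distrib diff_divide_distrib right_diff_distrib algebra_simps)
qed

text \<open>
  If \<open>h b > h a\<close>, then at the first point where \<open>h\<close> reaches the value \<open>h b\<close> the left difference quotients
  are nonnegative. A left derivative is thus enough for monotonicity, given continuity.
\<close>

lemma left_scale_deriv_neg_imp_le:
  assumes mono: "strict_mono_on {a..b} S" and ab: "a \<le> b" and h: "continuous_on {a..b} h"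
    and D: "\<And>z. a < z \<Longrightarrow> z \<le> b \<Longrightarrow> has_left_scale_deriv S h (D z) z" "\<And>z. a < z \<Longrightarrow> z \<le> b \<Longrightarrow> D z < 0"
  shows "h b \<le> h a"
proof (rule ccontr)
  assume n: "\<not> h b \<le> h a"
  have "closed ({a..b} \<inter> h -` {h b..})"
    by (rule continuous_closed_preimage[OF h]) auto
  then have "compact ({a..b} \<inter> ({a..b} \<inter> h -` {h b..}))" by (intro compact_Int_closed) auto
  moreover have "{a..b} \<inter> ({a..b} \<inter> h -` {h b..}) = {t\<in>{a..b}. h b \<le> h t}" by auto
  ultimately have "compact {t\<in>{a..b}. h b \<le> h t}" by simp
  moreover have "b \<in> {t\<in>{a..b}. h b \<le> h t}" using ab by simp
  ultimately obtain z where z: "z \<in> {a..b}" "h b \<le> h z" and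
    zmin: "\<And>t. t \<in> {a..b} \<Longrightarrow> h b \<le> h t \<Longrightarrow> z \<le> t"
    using compact_attains_inf[of "{t\<in>{a..b}. h b \<le> h t}"] by blast
  have az: "a < z" using z n by (cases "a = z") auto
  have "\<forall>\<^sub>F t in at_left z. 0 \<le> (h t - h z) / (S t - S z)"
    using eventually_at_left_real[OF az]
  proof eventually_elim
    case (elim t)
    then have "S t < S z" using mono z by (auto simp: strict_mono_on_def)
    moreover have "h t < h b" using zmin[of t] elim z by force
    ultimately show ?case using z by (intro divide_nonpos_neg) auto
  qed
  then have "0 \<le> D z"
    using D(1)[of z] az z tendsto_lowerbound[of "\<lambda>t. (h t - h z) / (S t - S z)" "D z" "at_left z" 0]
    by (auto simp: has_left_scale_deriv_def)
  then show False using D(2)[of z] az z by auto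
qed

text \<open>
  Subtracting \<open>e * S\<close> makes the derivative negative; then \<open>e\<close> tends to \<open>0\<close>.
\<close>

lemma left_scale_deriv_zero_imp_le:
  assumes mono: "strict_mono_on {a..b} S" and S: "continuous_on {a..b} S"
    and ab: "a \<le> b" and f: "continuous_on {a..b} f"
    and D: "\<And>z. a < z \<Longrightarrow> z \<le> b \<Longrightarrow> has_left_scale_deriv S f 0 z"
  shows "f b \<le> f a"
proof -
  have le: "f b - e * S b \<le> f a - e * S a" if "0 < e" for e
  proof -
    have "f b + (- e) * S b \<le> f a + (- e) * S a"
    proof (rule left_scale_deriv_neg_imp_le[OF mono ab, where D = "\<lambda>_. 0 + (- e) * 1"])
      show "continuous_on {a..b} (\<lambda>t. f t + (- e) * S t)" by (intro continuous_intros f S)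
      show "has_left_scale_deriv S (\<lambda>t. f t + (- e) * S t) (0 + (- e) * 1) z" if "a < z" "z \<le> b" for z
        using D[OF that] has_left_scale_deriv_scale[OF mono that] by (rule has_left_scale_deriv_linear)
    qed (use that in simp)
    then show ?thesis by simp
  qed
  have Sab: "S a \<le> S b"
    using mono ab by (cases "a = b") (auto simp: strict_mono_on_def less_imp_le)
  show ?thesis
  proof (rule field_le_epsilon)
    fix e :: real assume e: "0 < e"
    have "f b - f a \<le> e / (1 + (S b - S a)) * (S b - S a)"
      using le[of "e / (1 + (S b - S a))"] e Sab by (simp add: right_diff_distrib)
    also have "\<dots> \<le> e" using e Sab by (simp add: field_simps)
    finally show "f b \<le> f a + e" by simp
  qed
qed

lemma left_scale_deriv_zero_imp_eq:
  assumes mono: "strict_mono_on {a..b} S" and S: "continuous_on {a..b} S"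
    and ab: "a \<le> b" and f: "continuous_on {a..b} f"
    and D: "\<And>z. a < z \<Longrightarrow> z \<le> b \<Longrightarrow> has_left_scale_deriv S f 0 z"
  shows "f b = f a"
proof (rule antisym)
  show "f b \<le> f a" by (rule left_scale_deriv_zero_imp_le[OF assms])
  have zero: "has_left_scale_deriv S (\<lambda>t. 0) 0 z" for z by (simp add: has_left_scale_deriv_def)
  have "has_left_scale_deriv S (\<lambda>t. - f t) 0 z" if "a < z" "z \<le> b" for z
    using has_left_scale_deriv_linear[OF zero D[OF that], of "- 1"] by simp
  then have "- f b \<le> - f a"
    using f by (intro left_scale_deriv_zero_imp_le[OF mono S ab]) (auto intro!: continuous_intros)
  then show "f a \<le> f b" by simp
qed

text \<open>
  The increments of the left derivative are integrals of \<open>u\<close> over \<open>m\<close>. Both \<open>u\<close> and the density of \<open>m\<close> are bounded on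
  compact intervals of the interior, so the left derivative is even Lipschitz there.
\<close>

lemma generator_solution_left_deriv_continuous:
  assumes u: "generator_solution l S m \<alpha> u" and m: "has_continuous_density l m"
    and a: "l < ereal a" and ab: "a \<le> b" and \<alpha>: "0 < \<alpha>"
  shows "continuous_on {a..b} (left_scale_deriv S u)"
proof -
  have sub: "{a..b} \<subseteq> {z. l < ereal z}"
  proof
    fix z assume "z \<in> {a..b}"
    then have "ereal a \<le> ereal z" by simp
    with a show "z \<in> {z. l < ereal z}" by (simp del: ereal_less_eq)
  qed
  obtain d where d: "continuous_on {z. l < ereal z} d" "\<And>z. l < ereal z \<Longrightarrow> 0 \<le> d z"
    and m_eq: "m = density lborel (\<lambda>z. ennreal (d z) * indicator {z. l < ereal z} z)"
    using m unfolding has_continuous_density_def by blast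
  have cu: "continuous_on {a..b} u" using u sub unfolding generator_solution_def
    by (blast intro: continuous_on_subset)
  have cd: "continuous_on {a..b} d" using d(1) sub by (rule continuous_on_subset)
  have "bounded (u ` {a..b})" "bounded (d ` {a..b})"
    by (intro compact_imp_bounded compact_continuous_image cu cd compact_Icc)+
  then obtain U0 D0 where UD: "\<forall>x\<in>u ` {a..b}. norm x \<le> U0" "\<forall>x\<in>d ` {a..b}. norm x \<le> D0"
    unfolding bounded_iff by blast
  have U0: "\<bar>u z\<bar> \<le> U0" and D0: "\<bar>d z\<bar> \<le> D0" if "z \<in> {a..b}" for z using UD that by auto
  define U where "U = max U0 0"
  define K where "K = max D0 0"
  have U: "\<bar>u z\<bar> \<le> U" "0 \<le> U" if "z \<in> {a..b}" for z using U0[OF that] by (auto simp: U_def)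
  have K: "d z \<le> K" if "z \<in> {a..b}" for z using D0[OF that] by (auto simp: K_def)
  have K0: "0 \<le> K" "0 \<le> U" by (auto simp: K_def U_def)
  have meas: "(\<lambda>z. ennreal (d z) * indicator {z. l < ereal z} z) \<in> borel_measurable lborel"
  proof -
    have "(\<lambda>z. indicator {z. l < ereal z} z *\<^sub>R d z) \<in> borel_measurable borel"
      by (rule borel_measurable_continuous_on_indicator[OF _ d(1)]) (simp add: open_interior borel_open)
    then have "(\<lambda>z. ennreal (indicator {z. l < ereal z} z *\<^sub>R d z)) \<in> borel_measurable borel" by measurable
    also have "(\<lambda>z. ennreal (indicator {z. l < ereal z} z *\<^sub>R d z)) = (\<lambda>z. ennreal (d z) * indicator {z. l < ereal z} z)"
      by (auto simp: indicator_def)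
    finally show ?thesis by simp
  qed
  have em: "emeasure m {p..<q} \<le> ennreal (K * (q - p))" if pq: "a \<le> p" "p \<le> q" "q \<le> b" for p q
  proof -
    have "emeasure m {p..<q} = (\<integral>\<^sup>+ z. ennreal (d z) * indicator {z. l < ereal z} z * indicator {p..<q} z \<partial>lborel)"
      unfolding m_eq by (rule emeasure_density[OF meas]) simp
    also have "\<dots> \<le> (\<integral>\<^sup>+ z. ennreal K * indicator {p..<q} z \<partial>lborel)"
      using K pq by (intro nn_integral_mono) (auto simp: indicator_def intro!: ennreal_leI)
    also have "\<dots> = ennreal (K * (q - p))"
      using pq K0 by (simp add: nn_integral_cmult_indicator ennreal_mult)
    finally show ?thesis .
  qed
  have bound: "\<bar>LINT z:{p..<q}|m. u z\<bar> \<le> U * (K * (q - p))" if pq: "a \<le> p" "p \<le> q" "q \<le> b" for p q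
  proof -
    have fin: "emeasure m {p..<q} < \<infinity>" using em[OF pq] by (rule le_less_trans) simp
    have sm: "{p..<q} \<in> sets m" by (simp add: m_eq)
    have "\<bar>LINT z:{p..<q}|m. u z\<bar> \<le> (\<integral>z. \<bar>indicator {p..<q} z *\<^sub>R u z\<bar> \<partial>m)"
      unfolding set_lebesgue_integral_def using integral_norm_bound[of m "\<lambda>z. indicator {p..<q} z *\<^sub>R u z"] by simp
    also have "\<dots> \<le> (\<integral>z. U * indicator {p..<q} z \<partial>m)"
    proof (rule integral_mono')
      show "integrable m (\<lambda>z. U * indicator {p..<q} z)"
        by (intro integrable_mult_right integrable_real_indicator sm fin)
      show "\<bar>indicator {p..<q} z *\<^sub>R u z\<bar> \<le> U * indicator {p..<q} z" "0 \<le> U * indicator {p..<q} z" for z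
        using U(1)[of z] pq K0 by (auto simp: indicator_def)
    qed
    also have "\<dots> = U * measure m {p..<q}" using sm by simp
    also have "\<dots> \<le> U * (K * (q - p))"
      using em[OF pq] K0 pq by (intro mult_left_mono) (auto simp: measure_def intro!: enn2real_leI)
    finally show ?thesis .
  qed
  have "(\<alpha> * (U * K))-lipschitz_on {a..b} (left_scale_deriv S u)"
  proof (rule lipschitz_onI)
    show "0 \<le> \<alpha> * (U * K)" using \<alpha> K0 by simp
    have *: "\<bar>left_scale_deriv S u q - left_scale_deriv S u p\<bar> \<le> \<alpha> * (U * K) * (q - p)"
      if pq: "a \<le> p" "p < q" "q \<le> b" for p q
    proof -
      have "p \<in> {a..b}" using pq by simp
      then have "l < ereal p" using sub by blast
      then have "left_scale_deriv S u q - left_scale_deriv S u p = \<alpha> * (LINT z:{p..<q}|m. u z)"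
        using u pq unfolding generator_solution_def by blast
      then show ?thesis using bound[of p q] pq \<alpha> by (simp add: abs_mult mult.assoc)
    qed
    fix p q assume "p \<in> {a..b}" "q \<in> {a..b}"
    then show "dist (left_scale_deriv S u p) (left_scale_deriv S u q) \<le> \<alpha> * (U * K) * dist p q"
      using *[of p q] *[of q p] by (cases p q rule: linorder_cases) (auto simp: dist_real_def abs_minus_commute)
  qed
  then show ?thesis by (rule lipschitz_on_continuous_on)
qed

lemma emeasure_dS_measure_Ioc:
  assumes S: "continuous_on {a..\<eta>} S" and mono: "strict_mono_on {a..\<eta>} S"
    and uv: "a \<le> u" "u \<le> v" "v \<le> \<eta>"
  shows "emeasure (dS_measure S a \<eta>) {u<..v} = ennreal (S v - S u)"
    and "emeasure (dS_measure S a \<eta>) {v} = 0"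
proof -
  let ?F = "\<lambda>z. S (max a (min \<eta> z))"
  have a\<eta>: "a \<le> \<eta>" using uv by simp
  have cF: "continuous_on UNIV ?F"
    by (rule continuous_on_compose2[OF S]) (use a\<eta> in \<open>auto intro!: continuous_intros\<close>)
  have mF: "?F x \<le> ?F y" if "x \<le> y" for x y
  proof -
    have "max a (min \<eta> x) \<le> max a (min \<eta> y)" using that by auto
    moreover have "S p \<le> S q" if "p \<le> q" "p \<in> {a..\<eta>}" "q \<in> {a..\<eta>}" for p q
      using mono that by (cases "p = q") (auto simp: strict_mono_on_def less_imp_le)
    ultimately show ?thesis using a\<eta> by auto
  qed
  have rc: "continuous (at_right x) ?F" for x
    using cF by (auto simp: continuous_on_eq_continuous_at intro: continuous_at_imp_continuous_at_within)
  have "emeasure (dS_measure S a \<eta>) {u<..v} = ?F v - ?F u"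
    unfolding dS_measure_def by (rule emeasure_interval_measure_Ioc[OF uv(2) mF rc])
  then show "emeasure (dS_measure S a \<eta>) {u<..v} = ennreal (S v - S u)" using uv by simp
  show "emeasure (dS_measure S a \<eta>) {v} = 0"
    using emeasure_interval_measure_Icc[OF order_refl[of v] mF cF] by (simp add: dS_measure_def)
qed

text \<open>
  The fundamental theorem of calculus for left derivatives with respect to \<open>S\<close>: the indefinite integral
  of \<open>b\<close> is continuous with the same left derivative as \<open>N\<close>, so the difference is constant. Near
  the left endpoint a bound on \<open>b\<close> takes the place of continuity, because \<open>b_rate\<close> at the start level may
  involve \<open>\<phi>\<close> at the boundary \<open>l\<close>.
\<close>

lemma left_scale_deriv_imp_integral:
  assumes a\<eta>: "a < \<eta>" and S: "continuous_on {a..\<eta>} S" and mono: "strict_mono_on {a..\<eta>} S"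
    and b: "continuous_on {a<..\<eta>} b" and C: "\<And>z. z \<in> {a<..\<eta>} \<Longrightarrow> \<bar>b z\<bar> \<le> C"
    and N: "continuous_on {a..\<eta>} N" and D: "\<And>z. z \<in> {a<..\<eta>} \<Longrightarrow> has_left_scale_deriv S N (b z) z"
  shows "N \<eta> - N a = (LINT z=ereal a..ereal \<eta>|dS_measure S a \<eta>. b z)"
proof -
  let ?\<mu> = "dS_measure S a \<eta>"
  have sets_\<mu> [measurable_cong]: "sets ?\<mu> = sets borel" by (simp add: dS_measure_def)
  have space_\<mu>: "space ?\<mu> = UNIV" by (simp add: dS_measure_def)
  note em = emeasure_dS_measure_Ioc[OF S mono]
  have Smono: "S p \<le> S q" if "a \<le> p" "p \<le> q" "q \<le> \<eta>" for p q
    using mono that by (cases "p = q") (auto simp: strict_mono_on_def less_imp_le)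
  have Sless: "S p < S q" if "a \<le> p" "p < q" "q \<le> \<eta>" for p q
    using mono that by (auto simp: strict_mono_on_def)
  have C0: "0 \<le> C" using C[of \<eta>] a\<eta> by auto
  have meas': "(\<lambda>z. indicator {u<..v} z *\<^sub>R b z) \<in> borel_measurable ?\<mu>" if "a \<le> u" "v \<le> \<eta>" for u v
    unfolding measurable_cong_sets[OF sets_\<mu> refl]
    by (rule borel_measurable_continuous_on_indicator[OF _ continuous_on_subset[OF b]]) (use that in auto)
  have const_int: "integrable ?\<mu> (\<lambda>z. indicator {u<..v} z *\<^sub>R (c::real))" if "a \<le> u" "u \<le> v" "v \<le> \<eta>" for u v c
    using em(1)[OF that] by (simp add: sets_\<mu> integrable_real_mult_indicator)
  have const_val: "(\<integral>z. indicator {u<..v} z *\<^sub>R (c::real) \<partial>?\<mu>) = (S v - S u) * c" if "a \<le> u" "u \<le> v" "v \<le> \<eta>" for u v c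
    using em(1)[OF that] Smono[OF that] by (simp add: measure_def space_\<mu>)
  have int: "integrable ?\<mu> (\<lambda>z. indicator {u<..v} z *\<^sub>R b z)" if uv: "a \<le> u" "u \<le> v" "v \<le> \<eta>" for u v
    by (rule Bochner_Integration.integrable_bound[OF const_int[OF uv, of C] meas'[OF uv(1,3)]])
      (use C C0 uv in \<open>auto simp: indicator_def\<close>)
  have diff_bound: "\<bar>(\<integral>z. indicator {u<..v} z *\<^sub>R b z \<partial>?\<mu>) - (S v - S u) * c\<bar> \<le> (S v - S u) * e"
    if uv: "a \<le> u" "u \<le> v" "v \<le> \<eta>" and e: "\<And>z. z \<in> {u<..v} \<Longrightarrow> \<bar>b z - c\<bar> \<le> e" for u v c e
  proof -
    have "(\<integral>z. indicator {u<..v} z *\<^sub>R b z \<partial>?\<mu>) - (S v - S u) * c =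
        (\<integral>z. indicator {u<..v} z *\<^sub>R b z - indicator {u<..v} z *\<^sub>R c \<partial>?\<mu>)"
      by (subst Bochner_Integration.integral_diff[OF int[OF uv] const_int[OF uv]]) (simp only: const_val[OF uv])
    also have "\<bar>\<dots>\<bar> \<le> (\<integral>z. \<bar>indicator {u<..v} z *\<^sub>R b z - indicator {u<..v} z *\<^sub>R c\<bar> \<partial>?\<mu>)"
      unfolding real_norm_def[symmetric] by (rule integral_norm_bound)
    also have "\<dots> \<le> (\<integral>z. indicator {u<..v} z *\<^sub>R e \<partial>?\<mu>)"
    proof (rule integral_mono)
      show "integrable ?\<mu> (\<lambda>z. \<bar>indicator {u<..v} z *\<^sub>R b z - indicator {u<..v} z *\<^sub>R c\<bar>)"
        by (intro integrable_abs Bochner_Integration.integrable_diff int[OF uv] const_int[OF uv])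
      show "integrable ?\<mu> (\<lambda>z. indicator {u<..v} z *\<^sub>R e)" by (rule const_int[OF uv])
      show "\<bar>indicator {u<..v} z *\<^sub>R b z - indicator {u<..v} z *\<^sub>R c\<bar> \<le> indicator {u<..v} z *\<^sub>R e" for z
        using e[of z] by (cases "z \<in> {u<..v}") auto
    qed
    finally show ?thesis unfolding const_val[OF uv] .
  qed
  define B where "B z = (\<integral>x. indicator {a<..z} x *\<^sub>R b x \<partial>?\<mu>)" for z
  have B_diff: "B v - B u = (\<integral>z. indicator {u<..v} z *\<^sub>R b z \<partial>?\<mu>)" if uv: "a \<le> u" "u \<le> v" "v \<le> \<eta>" for u v
  proof -
    have "B v = (\<integral>z. indicator {a<..u} z *\<^sub>R b z + indicator {u<..v} z *\<^sub>R b z \<partial>?\<mu>)"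
      unfolding B_def using uv by (intro Bochner_Integration.integral_cong) (auto simp: indicator_def)
    also have "\<dots> = B u + (\<integral>z. indicator {u<..v} z *\<^sub>R b z \<partial>?\<mu>)"
      unfolding B_def using uv by (intro Bochner_Integration.integral_add int) auto
    finally show ?thesis by simp
  qed
  have B_bound: "\<bar>B v - B u\<bar> \<le> C * \<bar>S v - S u\<bar>" if "u \<in> {a..\<eta>}" "v \<in> {a..\<eta>}" for u v
  proof -
    have *: "\<bar>B v - B u\<bar> \<le> C * \<bar>S v - S u\<bar>" if uv: "a \<le> u" "u \<le> v" "v \<le> \<eta>" for u v
      using diff_bound[OF uv, of 0 C] B_diff[OF uv] C Smono[OF uv] uv by (simp add: mult.commute)
    show ?thesis using *[of u v] *[of v u] that by (cases "u \<le> v") (auto simp: abs_minus_commute)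
  qed
  have B_cont: "continuous_on {a..\<eta>} B"
    unfolding continuous_on_def
  proof
    fix z assume z: "z \<in> {a..\<eta>}"
    have "((\<lambda>t. C * \<bar>S t - S z\<bar>) \<longlongrightarrow> C * \<bar>S z - S z\<bar>) (at z within {a..\<eta>})"
      using S z by (intro tendsto_intros) (simp add: continuous_on_def)
    then have lim: "((\<lambda>t. C * \<bar>S t - S z\<bar>) \<longlongrightarrow> 0) (at z within {a..\<eta>})" by simp
    have "\<forall>\<^sub>F t in at z within {a..\<eta>}. norm (B t - B z) \<le> C * \<bar>S t - S z\<bar>"
      unfolding eventually_at_filter real_norm_def
      by (rule always_eventually) (blast intro: B_bound z)
    then have "((\<lambda>t. B t - B z) \<longlongrightarrow> 0) (at z within {a..\<eta>})"
      by (rule Lim_null_comparison[OF _ lim])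
    then show "(B \<longlongrightarrow> B z) (at z within {a..\<eta>})" by (simp add: LIM_zero_iff)
  qed
  have B_deriv: "has_left_scale_deriv S B (b z) z" if z: "z \<in> {a<..\<eta>}" for z
    unfolding has_left_scale_deriv_def
  proof (rule tendstoI)
    fix e :: real assume e: "0 < e"
    obtain \<delta> where \<delta>: "0 < \<delta>" "\<And>t. t \<in> {a<..\<eta>} \<Longrightarrow> dist t z < \<delta> \<Longrightarrow> dist (b t) (b z) < e / 2"
      using b[unfolded continuous_on_iff, rule_format, OF z half_gt_zero[OF e]] by blast
    have "\<forall>\<^sub>F t in at_left z. t \<in> {max a (z - \<delta>)<..<z}"
      using z \<delta> by (intro eventually_at_left_real) auto
    then show "\<forall>\<^sub>F t in at_left z. dist ((B t - B z) / (S t - S z)) (b z) < e"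
    proof eventually_elim
      case (elim t)
      then have t: "a \<le> t" "t \<le> z" "z \<le> \<eta>" and tz: "t < z" using z by auto
      have pos: "0 < S z - S t" using Sless[OF t(1) tz t(3)] by simp
      have "\<bar>(B z - B t) - (S z - S t) * b z\<bar> \<le> (S z - S t) * (e / 2)"
        unfolding B_diff[OF t]
      proof (rule diff_bound[OF t])
        fix x assume "x \<in> {t<..z}"
        then show "\<bar>b x - b z\<bar> \<le> e / 2" using \<delta>(2)[of x] elim z by (auto simp: dist_real_def)
      qed
      then have "\<bar>((B z - B t) - (S z - S t) * b z) / (S z - S t)\<bar> \<le> e / 2"
        using pos by (simp add: abs_divide pos_divide_le_eq mult.commute)
      moreover have "((B z - B t) - (S z - S t) * b z) / (S z - S t) = (B t - B z) / (S t - S z) - b z"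
        using pos by (simp add: field_simps)
      ultimately show ?case using e by (simp add: dist_real_def)
    qed
  qed
  have "N \<eta> + (- 1) * B \<eta> = N a + (- 1) * B a"
  proof (rule left_scale_deriv_zero_imp_eq[OF mono S, of "\<lambda>z. N z + (- 1) * B z"])
    show "continuous_on {a..\<eta>} (\<lambda>z. N z + (- 1) * B z)" by (intro continuous_intros N B_cont)
    fix z assume "a < z" "z \<le> \<eta>"
    then show "has_left_scale_deriv S (\<lambda>z. N z + (- 1) * B z) 0 z"
      using has_left_scale_deriv_linear[OF D B_deriv, of z "- 1"] by simp
  qed (use a\<eta> in auto)
  moreover have "B a = 0" by (simp add: B_def)
  moreover have "B \<eta> = (LINT z=ereal a..ereal \<eta>|?\<mu>. b z)"
  proof -
    have "AE z in ?\<mu>. z \<noteq> \<eta>"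
      using em(2)[of \<eta> \<eta>] a\<eta> by (intro AE_I[of _ _ "{\<eta>}"]) (auto simp: sets_\<mu>)
    then have "AE z in ?\<mu>. indicator {a<..\<eta>} z *\<^sub>R b z = indicator {a<..<\<eta>} z *\<^sub>R b z"
      by eventually_elim (auto simp: indicator_def)
    moreover have "(\<lambda>z. indicator {a<..<\<eta>} z *\<^sub>R b z) \<in> borel_measurable ?\<mu>"
      unfolding measurable_cong_sets[OF sets_\<mu> refl]
      by (rule borel_measurable_continuous_on_indicator[OF _ continuous_on_subset[OF b]]) auto
    ultimately have "B \<eta> = (\<integral>z. indicator {a<..<\<eta>} z *\<^sub>R b z \<partial>?\<mu>)"
      unfolding B_def by (intro integral_cong_AE meas') (use a\<eta> in auto)
    also have "\<dots> = (LINT z=ereal a..ereal \<eta>|?\<mu>. b z)"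
      using a\<eta> by (simp add: interval_lebesgue_integral_def set_lebesgue_integral_def einterval_eq)
    finally show ?thesis .
  qed
  ultimately show ?thesis by simp
qed


section \<open>From two-sided exits to the exponential formula\<close>

text \<open>
  The analytic half of the argument. The function \<open>g\<close> stands for the no-drop transform; what is known of
  it is that it is multiplicative and lies between two quotients of \<open>W\<close>. For fixed \<open>c\<close> the function
  \<open>W c\<close> is a solution of the generator equation that vanishes at \<open>c\<close>.

  Then \<open>N = - ln g(a, \<cdot>)\<close> is additive, and by \<open>1 - g \<le> - ln g \<le> 1 / g - 1\<close> its increments lie between two
  relative increments of \<open>W\<close>, which have the same left derivative \<open>b_rate\<close>. All estimates are made in
  terms of \<open>k = \<psi> / \<phi>\<close>, which is increasing and hence bounded at the left end of the state space. They
  remain uniform as the level \<open>a - y\<close> tends to \<open>l\<close>, where \<open>\<phi>\<close> may tend to infinity.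
\<close>

lemma exit_squeeze_exponential:
  fixes \<psi> \<phi> :: "real \<Rightarrow> real" and W :: "real \<Rightarrow> real \<Rightarrow> real"
  defines "W \<equiv> \<lambda>c z. \<phi> c * \<psi> z - \<psi> c * \<phi> z"
  assumes la: "l < ereal a" and lya: "ereal y + l \<le> ereal a" and a\<eta>: "a < \<eta>" and y: "0 < y"
    and S: "continuous_on {z. l < ereal z} S" and mono: "strict_mono_on {z. l < ereal z} S"
    and c\<psi>: "continuous_on {z. l < ereal z} \<psi>" and c\<phi>: "continuous_on {z. l < ereal z} \<phi>"
    and pos\<psi>: "\<And>z. l < ereal z \<Longrightarrow> 0 < \<psi> z" and pos\<phi>: "\<And>z. l < ereal z \<Longrightarrow> 0 < \<phi> z"
    and inc: "\<And>c v. l < ereal c \<Longrightarrow> c < v \<Longrightarrow> \<psi> c < \<psi> v" and dec: "\<And>c v. l < ereal c \<Longrightarrow> c < v \<Longrightarrow> \<phi> v < \<phi> c"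
    and D\<psi>: "\<And>z. l < ereal z \<Longrightarrow> has_left_scale_deriv S \<psi> (left_scale_deriv S \<psi> z) z"
    and D\<phi>: "\<And>z. l < ereal z \<Longrightarrow> has_left_scale_deriv S \<phi> (left_scale_deriv S \<phi> z) z"
    and cD\<psi>: "continuous_on {a..\<eta>} (left_scale_deriv S \<psi>)" and cD\<phi>: "continuous_on {a..\<eta>} (left_scale_deriv S \<phi>)"
    and refl: "g a a = 1"
    and mult: "\<And>u v w. a \<le> u \<Longrightarrow> u \<le> v \<Longrightarrow> v \<le> w \<Longrightarrow> g u w = g u v * g v w"
    and g1: "\<And>u v. a \<le> u \<Longrightarrow> u \<le> v \<Longrightarrow> g u v \<le> (1::real)"
    and lower: "\<And>u v. a \<le> u \<Longrightarrow> u < v \<Longrightarrow> v - y < u \<Longrightarrow> W (v - y) u / W (v - y) v \<le> g u v"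
    and upper: "\<And>u v. a < u \<Longrightarrow> u < v \<Longrightarrow> g u v \<le> W (u - y) u / W (u - y) v"
  shows "g a \<eta> = exp (- (LINT z=ereal a..ereal \<eta>|dS_measure S a \<eta>. b_rate S \<phi> \<psi> z y))"
proof -
  let ?I = "{z. l < ereal z}"
  have int_ge: "l < ereal z" if "a \<le> z" for z
    using la that by (metis ereal_less_eq(3) less_le_trans)
  have int_shift: "l < ereal (z - d)" if "a \<le> z" "d \<le> y" "a < z \<or> d < y" for z d
    using lya la that by (cases l) auto
  have sub: "{a..\<eta>} \<subseteq> ?I" using int_ge by auto
  have isC\<psi>: "isCont \<psi> z" and isC\<phi>: "isCont \<phi> z" if "l < ereal z" for z
    using c\<psi> c\<phi> that by (auto simp: continuous_on_eq_continuous_at[OF open_interior])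
  define k where "k z = \<psi> z / \<phi> z" for z
  have ck: "continuous_on ?I k"
    unfolding k_def using pos\<phi> by (intro continuous_intros c\<psi> c\<phi>) force
  have k_less: "k c < k v" if "l < ereal c" "c < v" for c v
  proof -
    have v: "l < ereal v" using that by (metis ereal_less_eq(3) less_imp_le less_le_trans)
    show ?thesis unfolding k_def
      using inc[OF that] dec[OF that] pos\<psi>[OF that(1)] pos\<phi>[OF v] by (intro frac_less) auto
  qed
  have k_le: "k c \<le> k v" if "l < ereal c" "c \<le> v" for c v
    using k_less[of c v] that by (cases "c = v") auto
  have k_pos: "0 < k z" if "l < ereal z" for z using pos\<psi> pos\<phi> that by (simp add: k_def)
  have W_eq: "W c z = \<phi> c * (\<phi> z * (k z - k c))" if "l < ereal c" "l < ereal z" for c z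
    using pos\<phi>[OF that(1)] pos\<phi>[OF that(2)] by (simp add: W_def k_def field_simps)
  have W_pos: "0 < W c z" if "l < ereal c" "c < z" for c z
  proof -
    have z: "l < ereal z" using that by (metis ereal_less_eq(3) less_imp_le less_le_trans)
    show ?thesis unfolding W_eq[OF that(1) z] using k_less[OF that] pos\<phi>[OF that(1)] pos\<phi>[OF z] by simp
  qed
  have W_diff: "W c v - W c u = \<phi> c * ((\<psi> v - \<psi> u) + k c * (\<phi> u - \<phi> v))" if "l < ereal c" for c u v
    using pos\<phi>[OF that] by (simp add: W_def k_def field_simps)
  \<comment> \<open>The shift by \<open>y / 2\<close> keeps \<open>z - y / 2\<close> inside the interior uniformly for \<open>z\<close> in \<open>{a..\<eta>}\<close>, so compactness applies; \<open>z - y\<close> may approach \<open>l\<close>.\<close>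
  obtain m0 where m0: "0 < m0" "\<And>z. a \<le> z \<Longrightarrow> z \<le> \<eta> \<Longrightarrow> m0 \<le> k z - k (z - y / 2)"
  proof -
    have sh: "(\<lambda>z. z - y / 2) ` {a..\<eta>} \<subseteq> ?I"
      by (rule image_subsetI) (use int_shift[of _ "y / 2"] y in simp)
    have "continuous_on {a..\<eta>} (\<lambda>z. k (z - y / 2))"
      by (rule continuous_on_compose2[OF ck _ sh]) (intro continuous_intros)
    then have "continuous_on {a..\<eta>} (\<lambda>z. k z - k (z - y / 2))"
      by (intro continuous_intros continuous_on_subset[OF ck sub])
    then obtain z0 where z0: "z0 \<in> {a..\<eta>}" "\<And>z. z \<in> {a..\<eta>} \<Longrightarrow> k z0 - k (z0 - y / 2) \<le> k z - k (z - y / 2)"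
      using continuous_attains_inf[of "{a..\<eta>}" "\<lambda>z. k z - k (z - y / 2)"] a\<eta> by auto
    have "0 < k z0 - k (z0 - y / 2)"
      using k_less[of "z0 - y / 2" z0] int_shift[of z0 "y / 2"] z0(1) y by auto
    then show ?thesis using z0(2) that[of "k z0 - k (z0 - y / 2)"] by auto
  qed
  define K where "K = k \<eta>"
  have denom: "\<phi> \<eta> * m0 \<le> \<phi> u * (k u - k c)" "0 < k c" "k c \<le> K"
    if "l < ereal c" "c \<le> u - y / 2" "a \<le> u" "u \<le> \<eta>" for c u
  proof -
    have "\<phi> \<eta> \<le> \<phi> u" using dec[of u \<eta>] int_ge that by (cases "u = \<eta>") auto
    moreover have "m0 \<le> k u - k c" using m0(2)[of u] k_le[OF that(1,2)] that by auto
    ultimately show "\<phi> \<eta> * m0 \<le> \<phi> u * (k u - k c)"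
      using m0 pos\<phi>[of \<eta>] int_ge[of \<eta>] a\<eta> by (intro mult_mono) auto
    show "0 < k c" by (rule k_pos[OF that(1)])
    show "k c \<le> K" unfolding K_def using k_le[of c \<eta>] that y by auto
  qed
  have \<phi>m0: "0 < \<phi> \<eta> * m0" using m0 pos\<phi>[of \<eta>] int_ge[of \<eta>] a\<eta> by simp
  \<comment> \<open>A modulus of continuity for \<open>N\<close>, from replacing \<open>k c\<close> and the denominator by their bounds.\<close>
  define \<omega> where "\<omega> z = (\<psi> z - K * \<phi> z) / (\<phi> \<eta> * m0)" for z
  have g_step_pos: "0 < g u v" if "a \<le> u" "u < v" "v - y < u" for u v
  proof -
    have "l < ereal (v - y)" using int_shift[of v y] that by auto
    then have "0 < W (v - y) u / W (v - y) v" using W_pos that y by auto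
    also have "\<dots> \<le> g u v" using lower that by auto
    finally show ?thesis .
  qed
  have g_pos: "0 < g a v" if "a \<le> v" for v
  proof -
    \<comment> \<open>The lower bound is positive for steps shorter than \<open>y\<close>; steps of length \<open>y / 2\<close> reach every level.\<close>
    have "0 < g a v" if "a \<le> v" "v - a \<le> real n * (y / 2)" for n v
      using that
    proof (induction n arbitrary: v)
      case 0
      then have "v = a" by simp
      then show ?case using refl by simp
    next
      case (Suc n)
      define u where "u = max a (v - y / 2)"
      have u: "a \<le> u" "u \<le> v" "v - y < u" using Suc.prems y by (auto simp: u_def)
      have "0 \<le> real n * (y / 2)" using y by simp
      then have "u - a \<le> real n * (y / 2)" using Suc.prems y by (auto simp: u_def max_def algebra_simps)
      then have "0 < g a u" using Suc.IH u by blast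
      moreover have "0 < g u v \<or> u = v" using g_step_pos[of u v] u by (cases "u = v") auto
      ultimately show ?case using mult[of a u v] u by auto
    qed
    moreover obtain n where "(v - a) / (y / 2) \<le> real n" using real_arch_simple by blast
    ultimately show ?thesis using that y by (auto simp: field_simps)
  qed
  define N where "N z = - ln (g a z)" for z
  have g_pos': "0 < g u v" if "a \<le> u" "u \<le> v" for u v
    using mult[of a u v] g_pos[of u] g_pos[of v] that by (simp add: zero_less_mult_iff)
  have N_diff: "N v - N u = - ln (g u v)" if "a \<le> u" "u \<le> v" for u v
    using mult[of a u v] that g_pos[of u] g_pos'[of u v] by (simp add: N_def ln_mult)
  have N_upper: "N v - N u \<le> (W (v - y) v - W (v - y) u) / W (v - y) u"
    if uv: "a \<le> u" "u < v" "v - y < u" for u v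
  proof -
    have lc: "l < ereal (v - y)" using int_shift[of v y] uv by auto
    have pos: "0 < W (v - y) u" "0 < W (v - y) v" using W_pos[OF lc] uv y by auto
    have "ln (W (v - y) u / W (v - y) v) \<le> ln (g u v)"
      using lower[OF uv] pos g_pos'[of u v] uv by simp
    then have "N v - N u \<le> ln (W (v - y) v / W (v - y) u)"
      using N_diff[of u v] uv pos by (simp add: ln_div)
    also have "\<dots> \<le> W (v - y) v / W (v - y) u - 1" using pos by (intro ln_le_minus_one) auto
    also have "\<dots> = (W (v - y) v - W (v - y) u) / W (v - y) u" using pos by (simp add: diff_divide_distrib)
    finally show ?thesis .
  qed
  have N_lower: "(W (u - y) v - W (u - y) u) / W (u - y) v \<le> N v - N u"
    if uv: "a < u" "u < v" for u v
  proof -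
    have lc: "l < ereal (u - y)" using int_shift[of u y] uv by auto
    have pos: "0 < W (u - y) v" using W_pos[OF lc] uv y by auto
    have "(W (u - y) v - W (u - y) u) / W (u - y) v = 1 - W (u - y) u / W (u - y) v"
      using pos by (simp add: diff_divide_distrib)
    also have "\<dots> \<le> 1 - g u v" using upper[OF uv] by simp
    also have "\<dots> \<le> - ln (g u v)" using ln_le_minus_one[of "g u v"] g_pos'[of u v] uv by simp
    finally show ?thesis using N_diff[of u v] uv by simp
  qed
  have N_mono: "N u \<le> N v" if "a \<le> u" "u \<le> v" for u v
  proof -
    have "ln (g u v) \<le> 0" using g1[OF that] g_pos'[OF that] by simp
    then show ?thesis using N_diff[OF that] by linarith
  qed
  have N_modulus: "N v - N u \<le> \<omega> v - \<omega> u" if uv: "a \<le> u" "u \<le> v" "v \<le> \<eta>" "v - u \<le> y / 2" for u v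
  proof (cases "u = v")
    case False
    then have less: "u < v" using uv by simp
    define c where "c = v - y"
    have lc: "l < ereal c" unfolding c_def using int_shift[of v y] uv less by auto
    have lu: "l < ereal u" using int_ge uv by simp
    note d = denom[OF lc, of u]
    have cu: "c \<le> u - y / 2" using uv by (simp add: c_def)
    have num: "0 \<le> \<psi> v - \<psi> u" "0 \<le> \<phi> u - \<phi> v" using inc[OF lu less] dec[OF lu less] by auto
    have "N v - N u \<le> (W c v - W c u) / W c u"
      unfolding c_def using N_upper[of u v] uv less y by auto
    also have "\<dots> = ((\<psi> v - \<psi> u) + k c * (\<phi> u - \<phi> v)) / (\<phi> u * (k u - k c))"
      unfolding W_diff[OF lc] unfolding W_eq[OF lc lu] using pos\<phi>[OF lc] by simp
    also have "\<dots> \<le> ((\<psi> v - \<psi> u) + K * (\<phi> u - \<phi> v)) / (\<phi> \<eta> * m0)"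
    proof (rule frac_le)
      show "(\<psi> v - \<psi> u) + k c * (\<phi> u - \<phi> v) \<le> (\<psi> v - \<psi> u) + K * (\<phi> u - \<phi> v)"
        using d(3) cu uv num by (intro add_left_mono mult_right_mono) auto
      show "0 \<le> (\<psi> v - \<psi> u) + K * (\<phi> u - \<phi> v)"
        using num d(2,3) cu uv by (intro add_nonneg_nonneg mult_nonneg_nonneg) auto
    qed (use \<phi>m0 d(1) cu uv in auto)
    also have "\<dots> = \<omega> v - \<omega> u" by (simp add: \<omega>_def diff_divide_distrib[symmetric] algebra_simps)
    finally show ?thesis .
  qed simp
  have N_cont: "continuous_on {a..\<eta>} N"
    unfolding continuous_on_def
  proof
    fix z assume z: "z \<in> {a..\<eta>}"
    have "continuous_on {a..\<eta>} \<omega>"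
      unfolding \<omega>_def using \<phi>m0
      by (intro continuous_intros continuous_on_subset[OF c\<psi> sub] continuous_on_subset[OF c\<phi> sub]) auto
    then have "((\<lambda>t. \<bar>\<omega> t - \<omega> z\<bar>) \<longlongrightarrow> \<bar>\<omega> z - \<omega> z\<bar>) (at z within {a..\<eta>})"
      using z by (intro tendsto_intros) (simp add: continuous_on_def)
    then have lim: "((\<lambda>t. \<bar>\<omega> t - \<omega> z\<bar>) \<longlongrightarrow> 0) (at z within {a..\<eta>})" by simp
    have "\<forall>\<^sub>F t in at z within {a..\<eta>}. norm (N t - N z) \<le> \<bar>\<omega> t - \<omega> z\<bar>"
      unfolding eventually_at
    proof (intro exI[of _ "y / 2"] conjI ballI impI)
      fix t assume t: "t \<in> {a..\<eta>}" and "t \<noteq> z \<and> dist t z < y / 2"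
      then have tz: "\<bar>t - z\<bar> \<le> y / 2" by (simp add: dist_real_def)
      show "norm (N t - N z) \<le> \<bar>\<omega> t - \<omega> z\<bar>"
      proof (cases "t \<le> z")
        case True
        then show ?thesis using N_modulus[of t z] N_mono[of t z] t z tz by auto
      next
        case False
        then show ?thesis using N_modulus[of z t] N_mono[of z t] t z tz by auto
      qed
    qed (use y in auto)
    then have "((\<lambda>t. N t - N z) \<longlongrightarrow> 0) (at z within {a..\<eta>})"
      by (rule Lim_null_comparison[OF _ lim])
    then show "(N \<longlongrightarrow> N z) (at z within {a..\<eta>})" by (simp add: LIM_zero_iff)
  qed
  let ?b = "\<lambda>z. b_rate S \<phi> \<psi> z y"
  have b_eq: "?b z = (\<phi> (z - y) * left_scale_deriv S \<psi> z - left_scale_deriv S \<phi> z * \<psi> (z - y)) / W (z - y) z" for z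
    by (simp add: b_rate_def W_def mult.commute)
  have b_cont: "continuous_on {a<..\<eta>} ?b"
    unfolding b_eq
  proof (intro continuous_intros)
    show "continuous_on {a<..\<eta>} (left_scale_deriv S \<psi>)" "continuous_on {a<..\<eta>} (left_scale_deriv S \<phi>)"
      by (rule continuous_on_subset[OF cD\<psi>] continuous_on_subset[OF cD\<phi>]; auto)+
    have sh: "(\<lambda>z. z - y) ` {a<..\<eta>} \<subseteq> ?I"
      by (rule image_subsetI) (use int_shift[of _ y] in simp)
    show c1: "continuous_on {a<..\<eta>} (\<lambda>z. \<phi> (z - y))" "continuous_on {a<..\<eta>} (\<lambda>z. \<psi> (z - y))"
      by (rule continuous_on_compose2[OF c\<phi> _ sh] continuous_on_compose2[OF c\<psi> _ sh]; intro continuous_intros)+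
    have sub': "{a<..\<eta>} \<subseteq> ?I" using int_ge by auto
    show "continuous_on {a<..\<eta>} (\<lambda>z. W (z - y) z)"
      unfolding W_def by (intro continuous_intros c1 continuous_on_subset[OF c\<psi> sub'] continuous_on_subset[OF c\<phi> sub'])
    show "\<forall>z\<in>{a<..\<eta>}. W (z - y) z \<noteq> 0"
    proof
      fix z assume "z \<in> {a<..\<eta>}"
      then have "0 < W (z - y) z" using W_pos[of "z - y" z] int_shift[of z y] y by simp
      then show "W (z - y) z \<noteq> 0" by simp
    qed
  qed
  have "bounded (left_scale_deriv S \<psi> ` {a..\<eta>})" "bounded (left_scale_deriv S \<phi> ` {a..\<eta>})"
    by (intro compact_imp_bounded compact_continuous_image cD\<psi> cD\<phi> compact_Icc)+
  then obtain C1 C2 where "\<forall>x\<in>left_scale_deriv S \<psi> ` {a..\<eta>}. norm x \<le> C1" "\<forall>x\<in>left_scale_deriv S \<phi> ` {a..\<eta>}. norm x \<le> C2"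
    unfolding bounded_iff by blast
  then have C: "\<bar>left_scale_deriv S \<psi> z\<bar> \<le> C1" "\<bar>left_scale_deriv S \<phi> z\<bar> \<le> C2" if "z \<in> {a..\<eta>}" for z
    using that by auto
  have b_bound: "\<bar>?b z\<bar> \<le> (C1 + K * C2) / (\<phi> \<eta> * m0)" if z: "z \<in> {a<..\<eta>}" for z
  proof -
    define c where "c = z - y"
    have lc: "l < ereal c" unfolding c_def using int_shift[of z y] z by auto
    have lz: "l < ereal z" using int_ge z by simp
    have "c \<le> z - y / 2" using y by (simp add: c_def)
    note d = denom[OF lc this]
    let ?p = "left_scale_deriv S \<psi> z" and ?q = "left_scale_deriv S \<phi> z"
    have num: "\<phi> c * ?p - ?q * \<psi> c = \<phi> c * (?p - k c * ?q)"
      using pos\<phi>[OF lc] by (simp add: k_def field_simps)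
    have "?b z = (?p - k c * ?q) / (\<phi> z * (k z - k c))"
      unfolding b_eq c_def[symmetric] W_eq[OF lc lz] num using pos\<phi>[OF lc] by simp
    then have "\<bar>?b z\<bar> = \<bar>?p - k c * ?q\<bar> / (\<phi> z * (k z - k c))"
      using d(1) \<phi>m0 z by (simp add: abs_divide)
    also have "\<dots> \<le> (C1 + K * C2) / (\<phi> \<eta> * m0)"
    proof (rule frac_le)
      have "\<bar>k c * ?q\<bar> \<le> K * C2" unfolding abs_mult
        using d(2,3) C(2)[of z] z by (intro mult_mono) auto
      then show "\<bar>?p - k c * ?q\<bar> \<le> C1 + K * C2" using C(1)[of z] z by auto
      then show "0 \<le> C1 + K * C2" by linarith
    qed (use \<phi>m0 d(1) z in auto)
    finally show ?thesis .
  qed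
  have N_deriv: "has_left_scale_deriv S N (?b v) v" if v: "v \<in> {a<..\<eta>}" for v
    unfolding has_left_scale_deriv_def
  proof (rule tendsto_sandwich)
    define q where "q u t = (u t - u v) / (S t - S v)" for u :: "real \<Rightarrow> real" and t
    have lv: "l < ereal v" and lvy: "l < ereal (v - y)" using int_ge[of v] int_shift[of v y] v by auto
    have q: "(q \<psi> \<longlongrightarrow> left_scale_deriv S \<psi> v) (at_left v)" "(q \<phi> \<longlongrightarrow> left_scale_deriv S \<phi> v) (at_left v)"
      using D\<psi>[OF lv] D\<phi>[OF lv] by (simp_all add: has_left_scale_deriv_def q_def[abs_def])
    have id: "((\<lambda>t. t) \<longlongrightarrow> v) (at_left v)" by (rule tendsto_ident_at)
    have sh: "((\<lambda>t. t - y) \<longlongrightarrow> v - y) (at_left v)" by (intro tendsto_intros)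
    have lims: "((\<lambda>t. \<psi> (t - y)) \<longlongrightarrow> \<psi> (v - y)) (at_left v)" "((\<lambda>t. \<phi> (t - y)) \<longlongrightarrow> \<phi> (v - y)) (at_left v)"
      "(\<psi> \<longlongrightarrow> \<psi> v) (at_left v)" "(\<phi> \<longlongrightarrow> \<phi> v) (at_left v)"
      using isCont_tendsto_compose[OF isC\<psi>[OF lvy] sh] isCont_tendsto_compose[OF isC\<phi>[OF lvy] sh]
        isCont_tendsto_compose[OF isC\<psi>[OF lv] id] isCont_tendsto_compose[OF isC\<phi>[OF lv] id] by auto
    have W0: "W (v - y) v \<noteq> 0" using W_pos[OF lvy, of v] y by simp
    show "((\<lambda>t. (\<phi> (t - y) * q \<psi> t - q \<phi> t * \<psi> (t - y)) / W (t - y) v) \<longlongrightarrow> ?b v) (at_left v)"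
      unfolding b_eq W_def by (intro tendsto_intros q lims W0[unfolded W_def])
    show "((\<lambda>t. (\<phi> (v - y) * q \<psi> t - q \<phi> t * \<psi> (v - y)) / W (v - y) t) \<longlongrightarrow> ?b v) (at_left v)"
      unfolding b_eq W_def by (intro tendsto_intros q lims W0[unfolded W_def])
    have ev: "\<forall>\<^sub>F t in at_left v. t \<in> {max a (v - y)<..<v}"
      using v y by (intro eventually_at_left_real) auto
    have quot: "(W c v - W c t) / d / (S v - S t) = (\<phi> c * q \<psi> t - q \<phi> t * \<psi> c) / d" if "S t < S v" for c d t
    proof -
      have "q u t = (u v - u t) / (S v - S t)" for u :: "real \<Rightarrow> real"
        unfolding q_def by (metis minus_diff_eq minus_divide_divide)
      then have "\<phi> c * q \<psi> t - q \<phi> t * \<psi> c = (W c v - W c t) / (S v - S t)"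
        by (simp add: W_def diff_divide_distrib[symmetric] algebra_simps)
      then show ?thesis by (simp add: mult.commute)
    qed
    have St: "S t < S v" if "t \<in> {max a (v - y)<..<v}" for t
      using mono int_ge[of t] lv that by (auto simp: strict_mono_on_def)
    have Nq: "(N t - N v) / (S t - S v) = (N v - N t) / (S v - S t)" for t
      by (metis minus_diff_eq minus_divide_divide)
    show "\<forall>\<^sub>F t in at_left v. (\<phi> (t - y) * q \<psi> t - q \<phi> t * \<psi> (t - y)) / W (t - y) v \<le> (N t - N v) / (S t - S v)"
      using ev
    proof eventually_elim
      case (elim t)
      show ?case unfolding Nq quot[OF St[OF elim], symmetric]
        using N_lower[of t v] elim St[OF elim] by (intro divide_right_mono) auto
    qed
    show "\<forall>\<^sub>F t in at_left v. (N t - N v) / (S t - S v) \<le> (\<phi> (v - y) * q \<psi> t - q \<phi> t * \<psi> (v - y)) / W (v - y) t"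
      using ev
    proof eventually_elim
      case (elim t)
      show ?case unfolding Nq quot[OF St[OF elim], symmetric]
        using N_upper[of t v] elim St[OF elim] by (intro divide_right_mono) auto
    qed
  qed
  have "N \<eta> - N a = (LINT z=ereal a..ereal \<eta>|dS_measure S a \<eta>. ?b z)"
    using mono int_ge
    by (intro left_scale_deriv_imp_integral[OF a\<eta> continuous_on_subset[OF S sub] _ b_cont b_bound N_cont N_deriv])
      (auto simp: strict_mono_on_def)
  then have "ln (g a \<eta>) = - (LINT z=ereal a..ereal \<eta>|dS_measure S a \<eta>. ?b z)"
    by (simp add: N_def refl)
  then show ?thesis using g_pos[of \<eta>] a\<eta> by (metis exp_ln less_imp_le)
qed

context regular_diffusion
begin

text \<open>
  Splitting the passage upwards to \<open>v\<close> and the passage downwards to \<open>c\<close> gives two linear equations for the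
  two exit transforms; this is Cramer's rule. The determinant is positive because neither passage
  takes time zero.
\<close>

lemma exit_transform_formula:
  assumes \<alpha>: "0 < \<alpha>" and \<psi>: "increasing_solution P X l I S m \<alpha> \<psi>" and \<phi>: "decreasing_solution P X l S m \<alpha> \<phi>"
    and c: "l < ereal c" and uv: "c < u" "u \<le> v"
  shows "exit_transform \<alpha> c u v = (\<phi> c * \<psi> u - \<psi> c * \<phi> u) / (\<phi> c * \<psi> v - \<psi> c * \<phi> v)"
proof -
  have u: "l < ereal u" using c uv by (metis ereal_less_eq(3) less_imp_le less_le_trans)
  have v: "l < ereal v" using u uv by (metis ereal_less_eq(3) less_le_trans)
  note I = interior_in_I[OF c] interior_in_I[OF u] interior_in_I[OF v]
  have pos: "0 < \<psi> c" "0 < \<psi> u" "0 < \<psi> v" "0 < \<phi> c" "0 < \<phi> u" "0 < \<phi> v"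
    using \<psi> \<phi> I c u v by (auto simp: increasing_solution_def decreasing_solution_def)
  have up: "hit_transform \<alpha> u v = \<psi> u / \<psi> v" "hit_transform \<alpha> c v = \<psi> c / \<psi> v"
    using \<psi> I uv by (auto simp: increasing_solution_def hit_transform_def)
  have down: "hit_transform \<alpha> u c = \<phi> u / \<phi> c" "hit_transform \<alpha> v c = \<phi> v / \<phi> c"
    using \<phi> c uv by (auto simp: decreasing_solution_def hit_transform_def)
  let ?p = "exit_transform \<alpha> c u v" and ?q = "exit_transform \<alpha> v u c"
  have ne: "c \<noteq> v" using uv by simp
  have "\<psi> c / \<psi> v < 1" "\<phi> v / \<phi> c < 1"
    using hit_transform_less_1[OF I(1) ne \<alpha>] hit_transform_less_1[OF I(3) ne[symmetric] \<alpha>] up down by auto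
  then have lt: "\<psi> c < \<psi> v" "\<phi> v < \<phi> c" using pos by auto
  have "\<psi> c * \<phi> v < \<psi> v * \<phi> c" using lt pos by (intro mult_strict_mono) auto
  then have W: "0 < \<phi> c * \<psi> v - \<psi> c * \<phi> v" by (simp add: mult.commute)
  have "\<psi> u / \<psi> v = ?p + ?q * (\<psi> c / \<psi> v)"
    using hit_transform_split[OF I(2) c ne \<alpha>] up by simp
  then have e1: "\<psi> u = ?p * \<psi> v + ?q * \<psi> c" using pos by (simp add: field_simps)
  have "\<phi> u / \<phi> c = ?q + ?p * (\<phi> v / \<phi> c)"
    using hit_transform_split[OF I(2) v ne[symmetric] \<alpha>] down by simp
  then have e2: "\<phi> u = ?q * \<phi> c + ?p * \<phi> v" using pos by (simp add: field_simps)
  have "?p * (\<phi> c * \<psi> v - \<psi> c * \<phi> v) = \<phi> c * \<psi> u - \<psi> c * \<phi> u"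
    unfolding e1 e2 by (simp add: algebra_simps)
  then show ?thesis using W by (simp add: eq_divide_eq)
qed

end

section \<open>Hitting time and maximum decrease\<close>

theorem theorem3p7:
  fixes M :: "'w measure"
    and P :: "real \<Rightarrow> 'w measure"
    and X :: "real \<Rightarrow> 'w \<Rightarrow> ereal"
    and l :: ereal
    and I :: "real set"
    and S :: "real \<Rightarrow> real"
    and m :: "real measure"
    and \<psi> \<phi> :: "real \<Rightarrow> real"
    and \<alpha> x y \<eta> :: real
  assumes "regular_diffusion M P X l I"
    and "scale_function M P X l S" and "continuously_differentiable l S"
    and "speed_measure P X l S m" and "has_continuous_density l m"
    and "class1 M P X l I S \<or> class2 M P X l I S"
    and "\<alpha> > 0"
    and "increasing_solution P X l I S m \<alpha> \<psi>"
    and "decreasing_solution P X l S m \<alpha> \<phi>"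
    and "x \<in> I" and "y > 0" and "\<eta> > start_level l x y"
  shows "(\<integral>\<omega>. discount \<alpha> (hit X \<eta> \<omega>) *
              indicator {\<omega>\<in>space M. max_decrease X (enn2real (hit X \<eta> \<omega>)) \<omega> < ereal y} \<omega> \<partial>P x) =
         \<psi> x / \<psi> (start_level l x y) *
         exp (- (LINT z=ereal (start_level l x y)..ereal \<eta>|dS_measure S (start_level l x y) \<eta>.
                   b_rate S \<phi> \<psi> z y))"
proof -
  interpret regular_diffusion M P X l I by (rule assms(1))
  note \<alpha> = \<open>\<alpha> > 0\<close> and \<psi> = assms(8) and \<phi> = assms(9) and x = \<open>x \<in> I\<close> and y = \<open>y > 0\<close>
  define a where "a = start_level l x y"
  have a\<eta>: "a < \<eta>" using assms(12) by (simp add: a_def)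
  have lx: "l \<le> ereal x" using x subset_closure by auto
  have a_eq: "ereal a = max (ereal x) (ereal y + l)"
    unfolding a_def start_level_def using l_less_infty by (cases l) (auto simp: max_def)
  have xa: "x \<le> a" and lya: "ereal y + l \<le> ereal a"
    using a_eq by (metis ereal_less_eq(3) max.cobounded1, metis max.cobounded2)
  have la: "l < ereal a" using lya lx xa y by (cases l) auto
  have aI: "a \<in> I" using la by (rule interior_in_I)
  have int_ge: "l < ereal z" if "a \<le> z" for z using la that by (metis ereal_less_eq(3) less_le_trans)
  have int_shift: "l < ereal (z - y)" if "a < z" for z using lya la that by (cases l) auto
  have gs: "generator_solution l S m \<alpha> \<psi>" "generator_solution l S m \<alpha> \<phi>"
    using \<psi> \<phi> by (auto simp: increasing_solution_def decreasing_solution_def)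
  have less1: "\<psi> c < \<psi> v" "\<phi> v < \<phi> c" if c: "l < ereal c" and cv: "c < v" for c v
  proof -
    have v: "l < ereal v" using c cv by (metis ereal_less_eq(3) less_imp_le less_le_trans)
    have "hit_transform \<alpha> c v = \<psi> c / \<psi> v" "0 < \<psi> v"
      using \<psi> interior_in_I[OF c] interior_in_I[OF v] cv by (auto simp: increasing_solution_def hit_transform_def)
    then show "\<psi> c < \<psi> v" using hit_transform_less_1[OF interior_in_I[OF c] _ \<alpha>, of v] cv by simp
    have "hit_transform \<alpha> v c = \<phi> v / \<phi> c" "0 < \<phi> c"
      using \<phi> c cv by (auto simp: decreasing_solution_def hit_transform_def)
    then show "\<phi> v < \<phi> c" using hit_transform_less_1[OF interior_in_I[OF v] _ \<alpha>, of c] cv by simp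
  qed
  have D: "has_left_scale_deriv S f (left_scale_deriv S f z) z"
    if "generator_solution l S m \<alpha> f" "l < ereal z" for f z
    using that left_scale_deriv_eq unfolding generator_solution_def by metis
  have "no_drop_transform \<alpha> y a \<eta> =
      exp (- (LINT z=ereal a..ereal \<eta>|dS_measure S a \<eta>. b_rate S \<phi> \<psi> z y))"
  proof (rule exit_squeeze_exponential[OF la lya a\<eta> y])
    show "continuous_on {z. l < ereal z} S" "strict_mono_on {z. l < ereal z} S"
      using assms(2) by (auto simp: scale_function_def)
    show "continuous_on {z. l < ereal z} \<psi>" "continuous_on {z. l < ereal z} \<phi>"
      using gs by (auto simp: generator_solution_def)
    show "0 < \<psi> z" "0 < \<phi> z" if "l < ereal z" for z
      using \<psi> \<phi> that interior_in_I by (auto simp: increasing_solution_def decreasing_solution_def)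
    show "continuous_on {a..\<eta>} (left_scale_deriv S \<psi>)" "continuous_on {a..\<eta>} (left_scale_deriv S \<phi>)"
      using generator_solution_left_deriv_continuous[OF _ assms(5) la less_imp_le[OF a\<eta>] \<alpha>] gs by auto
    show "no_drop_transform \<alpha> y a a = 1" by (rule no_drop_transform_refl[OF aI y])
    show "no_drop_transform \<alpha> y u w = no_drop_transform \<alpha> y u v * no_drop_transform \<alpha> y v w"
      if "a \<le> u" "u \<le> v" "v \<le> w" for u v w
      using that int_ge interior_in_I by (intro no_drop_transform_mult[OF _ _ _ _ \<alpha> y]) auto
    show "no_drop_transform \<alpha> y u v \<le> 1" if "a \<le> u" "u \<le> v" for u v
      by (rule no_drop_transform_le_1[OF _ \<alpha> y]) (use int_ge interior_in_I that in auto)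
    show "(\<phi> (v - y) * \<psi> u - \<psi> (v - y) * \<phi> u) / (\<phi> (v - y) * \<psi> v - \<psi> (v - y) * \<phi> v) \<le> no_drop_transform \<alpha> y u v"
      if "a \<le> u" "u < v" "v - y < u" for u v
      using exit_transform_formula[OF \<alpha> \<psi> \<phi>, of "v - y" u v] int_shift[of v]
        no_drop_transform_ge_exit[of u v y \<alpha>] \<alpha> y interior_in_I[OF int_ge[of u]] that by simp
    show "no_drop_transform \<alpha> y u v \<le> (\<phi> (u - y) * \<psi> u - \<psi> (u - y) * \<phi> u) / (\<phi> (u - y) * \<psi> v - \<psi> (u - y) * \<phi> v)"
      if "a < u" "u < v" for u v
      using exit_transform_formula[OF \<alpha> \<psi> \<phi>, of "u - y" u v] int_shift[of u]
        no_drop_transform_le_exit[of u \<alpha> y v] \<alpha> y interior_in_I[OF int_ge[of u]] that by simp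
  qed (use less1 D gs in auto)
  moreover have "no_drop_transform \<alpha> y x \<eta> = no_drop_transform \<alpha> y x a * no_drop_transform \<alpha> y a \<eta>"
    using a\<eta> by (intro no_drop_transform_mult[OF x la xa _ \<alpha> y]) simp
  moreover have "no_drop_transform \<alpha> y x a = \<psi> x / \<psi> a"
  proof (cases "x = a")
    case True
    have "0 < \<psi> a" using \<psi> aI by (auto simp: increasing_solution_def)
    then show ?thesis using True no_drop_transform_refl[OF aI y] by simp
  next
    case False
    then have "ereal a \<le> ereal y + l" using a_eq by (auto simp: max_def split: if_splits)
    then have "no_drop_transform \<alpha> y x a = hit_transform \<alpha> x a"
      by (rule no_drop_transform_near_boundary[OF x xa _ \<alpha> y])
    also have "\<dots> = \<psi> x / \<psi> a" using \<psi> x aI xa by (auto simp: increasing_solution_def hit_transform_def)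
    finally show ?thesis .
  qed
  ultimately show ?thesis
    unfolding no_drop_transform_eq_max_decrease[OF x] a_def[symmetric] by simp
qed

end
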